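(* Let $\alpha>0$, $\gamma>0$, $T>0$, and let $\kappa$ be a fragmentation kernel (with total mass $N$). Let $q\ge0$ and let $\mu_0^q\in\mathcal M^+(\mathbb R^+)$ with $\operatorname{supp}(\mu_0^q)\subset[0,L]$ satisfy $$\|\mu_0^q-\delta(x-1)\|_{BL}\le q.$$ Let $\mu_t^q$ be the unique (non-negative) solution of the fragmentation equation with initial condition $\mu_0^q$. Let $\mu_0^{q,\varepsilon_0}$ and $\mu_t^{q,\varepsilon}$ be noisy measurements (measures in $\mathcal M(\mathbb R^+)$) of $\mu_0^q$ and $\mu_t^q$ respectively, such that $$\|\mu_0^{q,\varepsilon_0}-\mu_0^q\|_{BL}\le\varepsilon_0,\qquad \|\mu_t^{q,\varepsilon}-\mu_t^q\|_{BL}\le\varepsilon.$$ Assume moreover either $\gamma\ge1$ or $\operatorname{supp}(\mu_0^q)\subset[m,L]$ with $m>0$. Then there are constants $C_1=C_1(N,T,\alpha)$ and $C_2=C_2(L,N,T,\alpha,\gamma,m^{\gamma-1})$ (the dependence on $m^{\gamma-1}$ being relevant only in the second case) such that, for all $0<t\le T$, $$\Big\|\frac{\mu_t^{q,\varepsilon}-e^{-\alpha t}\mu_0^{q,\varepsilon_0}}{\alpha t}-\kappa\Big\|_{BL}\le C_1t+\frac{\varepsilon_0+\varepsilon+C_2q}{\alpha t}.$$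
   Context: $\mathbb R^+=[0,\infty)$. $\mathcal M(\mathbb R^+)$ is the space of signed Radon measures supported in $\mathbb R^+$, endowed with the total variation norm $\|\cdot\|_{TV}$, for which it is a Banach space (so its elements are finite measures); $\mathcal M^+(\mathbb R^+)$ is the subset of non-negative measures. The Bounded-Lipschitz norm is $\|\mu\|_{BL}=\sup\{\int_{\mathbb R^+}\varphi\,d\mu:\ \varphi\in\mathcal C(\mathbb R^+)\cap L^1(d|\mu|),\ \|\varphi\|_\infty\le1,\ \|\varphi'\|_\infty\le1\}$. $C(p_1,p_2,\dots)$ denotes a constant depending continuously on the listed parameters. Fragmentation kernel: $\kappa\in\mathcal M^+(\mathbb R^+)$ with no atom at $0$ nor at $1$, $\operatorname{supp}(\kappa)\subset[0,1]$, $\int_0^1 d\kappa(z)=N<+\infty$, $\int_0^1 z\,d\kappa(z)=1$. Fragmentation equation (formally): $\partial_t\mu_t(x)=-\alpha x^\gamma\mu_t(x)+\alpha\int_x^\infty\kappa(x/y)\,y^{\gamma-1}d\mu_t(y)$, $\mu_{t=0}=\mu_0$. A measure-valued solution is a family $(\mu_t)_{t\ge0}\subset\mathcal M(\mathbb R^+)$ such that $t\mapsto\mu_t$ is narrowly continuous and, for all $\varphi\in\mathcal C(\mathbb R^+)$ such that $x\mapsto\varphi(x)/(1+x)$ is bounded on $[0,\infty)$ and all $t\ge0$, $$\int_{\mathbb R^+}\varphi\,d\mu_t=\int_{\mathbb R^+}\varphi\,d\mu_0+\int_0^t ds\int_{\mathbb R^+}d\mu_s(x)\,\alpha x^\gamma\Big(-\varphi(x)+\int_0^1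 d\kappa(z)\varphi(xz)\Big).$$ For compactly supported $\mu_0\in\mathcal M^+(\mathbb R^+)$ there is a unique non-negative such solution in $\mathcal C(\mathbb R^+,(\mathcal M(\mathbb R^+),\|\cdot\|_{TV}))$; it is the solution meant in the claim. *)

theory Defs
  imports "HOL-Probability.Probability"
begin

section \<open>Signed measures on the half line\<close>

abbreviation half_line :: "real measure" where
  "half_line \<equiv> restrict_space borel {0..}"

text \<open>
  A signed measure is a real-valued, countably additive set function, extended by \<open>0\<close> to the
  non-Borel sets (as \<^const>\<open>measure\<close> does), so that equality of functions is equality of measures.
  Finite signed Borel measures on \<open>[0,\<infinity>)\<close> are automatically Radon.  Countable additivity forces
  \<open>\<nu> {} = 0\<close>: a constant sequence is summable only if it vanishes.
\<close>

definition signed_measures :: "(real set \<Rightarrow> real) set" where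
  "signed_measures = {\<nu>. (\<forall>A. A \<notin> sets half_line \<longrightarrow> \<nu> A = 0) \<and>
     (\<forall>A :: nat \<Rightarrow> real set. range A \<subseteq> sets half_line \<longrightarrow> disjoint_family A \<longrightarrow>
        (\<lambda>n. \<nu> (A n)) sums \<nu> (\<Union>n. A n))}"

definition nonneg_measures :: "(real set \<Rightarrow> real) set" where
  "nonneg_measures = {\<nu> \<in> signed_measures. \<forall>A. 0 \<le> \<nu> A}"

definition dirac :: "real \<Rightarrow> real set \<Rightarrow> real" where
  "dirac a = measure (return half_line a)"

text \<open>
  Jordan decomposition: \<open>\<nu>\<^sup>+(A)\<close> is the supremum of \<open>\<nu>(B)\<close> over Borel sets \<open>B \<subseteq> A\<close>.  Negative
  values, which \<^const>\<open>ennreal\<close> truncates to \<open>0\<close>, do not matter because \<open>B = {}\<close> is admissible.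
\<close>

definition pos_part :: "(real set \<Rightarrow> real) \<Rightarrow> real measure" where
  "pos_part \<nu> = measure_of {0..} (sets half_line)
     (\<lambda>A. SUP B \<in> {B \<in> sets half_line. B \<subseteq> A}. ennreal (\<nu> B))"

definition neg_part :: "(real set \<Rightarrow> real) \<Rightarrow> real measure" where
  "neg_part \<nu> = pos_part (\<lambda>A. - \<nu> A)"

definition variation :: "(real set \<Rightarrow> real) \<Rightarrow> real measure" where
  "variation \<nu> = measure_of {0..} (sets half_line)
     (\<lambda>A. emeasure (pos_part \<nu>) A + emeasure (neg_part \<nu>) A)"

definition signed_integral :: "(real set \<Rightarrow> real) \<Rightarrow> (real \<Rightarrow> real) \<Rightarrow> real" where
  "signed_integral \<nu> \<phi> = (LINT x|pos_part \<nu>. \<phi> x) - (LINT x|neg_part \<nu>. \<phi> x)"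

definition supp :: "(real set \<Rightarrow> real) \<Rightarrow> real set" where
  "supp \<nu> = {x \<in> {0..}. \<forall>U. open U \<and> x \<in> U \<longrightarrow> 0 < emeasure (variation \<nu>) (U \<inter> {0..})}"

definition tv_norm :: "(real set \<Rightarrow> real) \<Rightarrow> real" where
  "tv_norm \<nu> = measure (variation \<nu>) {0..}"

text \<open>
  The condition that the (weak) derivative of a continuous test function is bounded by \<open>1\<close> in
  the supremum norm means that the function is \<open>1\<close>-Lipschitz.  For a signed measure the set below
  is bounded by the total variation norm, so the supremum of reals is the intended one.
\<close>

definition bl_norm :: "(real set \<Rightarrow> real) \<Rightarrow> real" where
  "bl_norm \<nu> = Sup {signed_integral \<nu> \<phi> | \<phi>. continuous_on {0..} \<phi> \<and> integrable (variation \<nu>) \<phi> \<and>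
     (\<forall>x\<ge>0. \<bar>\<phi> x\<bar> \<le> 1) \<and> 1-lipschitz_on {0..} \<phi>}"


section \<open>The fragmentation equation\<close>

definition frag_kernel :: "real \<Rightarrow> (real set \<Rightarrow> real) \<Rightarrow> bool" where
  "frag_kernel N \<kappa> \<longleftrightarrow> \<kappa> \<in> nonneg_measures \<and> \<kappa> {0} = 0 \<and> \<kappa> {1} = 0 \<and> supp \<kappa> \<subseteq> {0..1} \<and>
     signed_integral \<kappa> (\<lambda>z. indicator {0..1} z) = N \<and>
     signed_integral \<kappa> (\<lambda>z. indicator {0..1} z * z) = 1"

definition frag_dual ::
    "real \<Rightarrow> real \<Rightarrow> (real set \<Rightarrow> real) \<Rightarrow> (real \<Rightarrow> real) \<Rightarrow> real \<Rightarrow> real" where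
  "frag_dual \<alpha> \<gamma> \<kappa> \<phi> x =
     \<alpha> * x powr \<gamma> * (- \<phi> x + signed_integral \<kappa> (\<lambda>z. indicator {0..1} z * \<phi> (x * z)))"

definition narrowly_continuous :: "(real \<Rightarrow> real set \<Rightarrow> real) \<Rightarrow> bool" where
  "narrowly_continuous \<mu> \<longleftrightarrow> (\<forall>\<phi>. continuous_on {0..} \<phi> \<and> bounded (\<phi> ` {0..}) \<longrightarrow>
     continuous_on {0..} (\<lambda>t. signed_integral (\<mu> t) \<phi>))"

definition tv_continuous :: "(real \<Rightarrow> real set \<Rightarrow> real) \<Rightarrow> bool" where
  "tv_continuous \<mu> \<longleftrightarrow>
     (\<forall>t\<ge>0. ((\<lambda>s. tv_norm (\<lambda>A. \<mu> s A - \<mu> t A)) \<longlongrightarrow> 0) (at t within {0..}))"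

text \<open>
  The integrability clauses express that the integrals in the weak formulation exist; without
  them, the library integrals would default to \<open>0\<close>.
\<close>

definition measure_solution ::
    "real \<Rightarrow> real \<Rightarrow> (real set \<Rightarrow> real) \<Rightarrow> (real set \<Rightarrow> real) \<Rightarrow> (real \<Rightarrow> real set \<Rightarrow> real) \<Rightarrow> bool" where
  "measure_solution \<alpha> \<gamma> \<kappa> \<mu>0 \<mu> \<longleftrightarrow>
     (\<forall>t\<ge>0. \<mu> t \<in> signed_measures) \<and> \<mu> 0 = \<mu>0 \<and> narrowly_continuous \<mu> \<and>
     (\<forall>\<phi>. continuous_on {0..} \<phi> \<and> bounded ((\<lambda>x. \<phi> x / (1 + x)) ` {0..}) \<longrightarrow>
        (\<forall>t\<ge>0.
           integrable (variation (\<mu> t)) \<phi> \<and>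
           (AE s in lborel. s \<in> {0..t} \<longrightarrow> integrable (variation (\<mu> s)) (frag_dual \<alpha> \<gamma> \<kappa> \<phi>)) \<and>
           set_integrable lborel {0..t} (\<lambda>s. signed_integral (\<mu> s) (frag_dual \<alpha> \<gamma> \<kappa> \<phi>)) \<and>
           signed_integral (\<mu> t) \<phi> = signed_integral \<mu>0 \<phi> +
             (LINT s:{0..t}|lborel. signed_integral (\<mu> s) (frag_dual \<alpha> \<gamma> \<kappa> \<phi>))))"

definition nonneg_tv_solution ::
    "real \<Rightarrow> real \<Rightarrow> (real set \<Rightarrow> real) \<Rightarrow> (real set \<Rightarrow> real) \<Rightarrow> (real \<Rightarrow> real set \<Rightarrow> real) \<Rightarrow> bool" where
  "nonneg_tv_solution \<alpha> \<gamma> \<kappa> \<mu>0 \<mu> \<longleftrightarrow>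
     measure_solution \<alpha> \<gamma> \<kappa> \<mu>0 \<mu> \<and> (\<forall>t\<ge>0. \<mu> t \<in> nonneg_measures) \<and> tv_continuous \<mu>"

end

theory Submission
  imports Defs
begin

text \<open>
  Write \<open>A \<phi> x = \<alpha> x\<^sup>\<gamma> (\<integral> \<phi>(x z) d\<kappa>(z) - \<phi>(x))\<close> for the dual fragmentation operator, so that the weak
  formulation reads \<open>\<langle>\<mu>\<^sub>t, \<phi>\<rangle> = \<langle>\<mu>\<^sub>0, \<phi>\<rangle> + \<integral>\<^sub>0\<^sup>t \<langle>\<mu>\<^sub>s, A \<phi>\<rangle> ds\<close>.  If the initial state were exactly the Dirac
  mass at \<open>1\<close>, a Taylor expansion in time would give \<open>\<langle>\<mu>\<^sub>t, \<phi>\<rangle> = \<phi>(1) + t A \<phi>(1) + O(t\<^sup>2)\<close>.  Since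
  \<open>x\<^sup>\<gamma> = 1\<close> at \<open>x = 1\<close>, we have \<open>A \<phi>(1) = \<alpha> (\<langle>\<kappa>, \<phi>\<rangle> - \<phi>(1))\<close>, and subtracting
  \<open>e\<^sup>-\<^sup>\<alpha>\<^sup>t \<phi>(1) = \<phi>(1) - \<alpha> t \<phi>(1) + O(t\<^sup>2)\<close> leaves \<open>\<alpha> t \<langle>\<kappa>, \<phi>\<rangle>\<close> up to \<open>O(t\<^sup>2)\<close>.  Division by \<open>\<alpha> t\<close>
  produces the term \<open>C\<^sub>1 t\<close>; the two measurement errors enter linearly.

  For an initial state that is only \<open>q\<close>-close to the Dirac mass the same expansion is carried out at
  \<open>\<mu>\<^sub>0\<close> (lemma \<open>second_order_expansion\<close>), and two points need care.

  The first is the replacement of \<open>\<mu>\<^sub>0\<close> by the Dirac mass (\<open>initial_close_to_dirac\<close>).  It is applied to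
  the function \<open>(1 - e\<^sup>-\<^sup>\<alpha>\<^sup>t) \<phi> + t A \<phi>\<close>, and costs \<open>q\<close> times a bound for this function and its Lipschitz
  constant on the support of \<open>\<mu>\<^sub>0\<close>.  The Lipschitz constant of \<open>A \<phi>\<close> involves that of \<open>x\<^sup>\<gamma>\<close>; this is the
  only place where \<open>\<gamma> \<ge> 1\<close> or a lower bound \<open>m\<close> of the support matters (\<open>A_lipschitz\<close>).

  The second is the Taylor remainder.  It is at most \<open>(\<alpha> (1 + N))\<^sup>2 t\<^sup>2\<close> times a bound for the moments
  \<open>\<langle>\<mu>\<^sub>s, x\<^sup>2\<^sup>\<gamma>\<rangle>\<close>, and \<open>C\<^sub>1\<close> must depend neither on \<open>L\<close> nor on \<open>\<gamma>\<close>.  The weight \<open>w = 1 + x\<^sup>p\<close> with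
  \<open>p = max 1 (2 \<gamma>)\<close> dominates \<open>x\<^sup>2\<^sup>\<gamma>\<close> and satisfies \<open>A w \<le> \<alpha> N w\<close>: as \<open>p \<ge> 1\<close>, the moment
  \<open>\<integral> z\<^sup>p d\<kappa> \<le> \<integral> z d\<kappa> = 1\<close> makes the leading terms cancel (\<open>A_weight_le\<close>).  Hence
  \<open>\<langle>\<mu>\<^sub>s, w\<rangle> \<le> 2 e\<^sup>2\<^sup>\<alpha>\<^sup>N\<^sup>s \<langle>\<mu>\<^sub>0, w\<rangle>\<close> by Gronwall (\<open>\<mu>_moment_bound\<close>), and \<open>\<langle>\<mu>\<^sub>0, w\<rangle> \<le> w(1) + O(q) = 2 + O(q)\<close>,
  so everything that depends on \<open>L\<close> and \<open>\<gamma>\<close> carries a factor \<open>q\<close> and goes into \<open>C\<^sub>2\<close>.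

  In general \<open>w\<close> and \<open>A \<phi>\<close> grow too fast for test functions.  They are truncated at \<open>L\<close>, which is
  harmless because no mass ever passes \<open>L\<close> (\<open>\<mu>_concentrated\<close>).  Finally, to split the integral against
  the noisy quotient into its parts, integration has to be linear in the signed measure; this rests on
  the Jordan decomposition, established first.
\<close>

section \<open>Jordan decomposition of signed measures\<close>

lemma signed_measure_empty:
  assumes "\<nu> \<in> signed_measures"
  shows "\<nu> {} = 0"
proof -
  have "(\<lambda>n::nat. \<nu> {}) sums \<nu> (\<Union>n::nat. {})"
    using assms by (auto simp: signed_measures_def disjoint_family_on_def)
  then show ?thesis
    using summable_const_iff sums_summable by blast
qed

lemma signed_measure_sums:
  assumes "\<nu> \<in> signed_measures" "\<And>n. A n \<in> sets half_line" "disjoint_family A"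
  shows "(\<lambda>n. \<nu> (A n)) sums \<nu> (\<Union>n. A n)"
  using assms by (auto simp: signed_measures_def)

lemma signed_measure_Un:
  assumes "\<nu> \<in> signed_measures" "A \<in> sets half_line" "B \<in> sets half_line" "A \<inter> B = {}"
  shows "\<nu> (A \<union> B) = \<nu> A + \<nu> B"
proof -
  have "(\<lambda>n. \<nu> (binaryset A B n)) sums \<nu> (\<Union>n. binaryset A B n)"
    using assms by (intro signed_measure_sums) (auto simp: binaryset_def disjoint_family_on_def)
  moreover have "(\<lambda>n. \<nu> (binaryset A B n)) sums (\<nu> A + \<nu> B)"
    using assms by (intro binaryset_sums signed_measure_empty)
  ultimately show ?thesis
    by (metis UN_binaryset_eq sums_unique2)
qed

lemma signed_measure_Diff:
  assumes "\<nu> \<in> signed_measures" "A \<in> sets half_line" "B \<in> sets half_line" "B \<subseteq> A"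
  shows "\<nu> (A - B) = \<nu> A - \<nu> B"
  using signed_measure_Un[of \<nu> "A - B" B] assms by (simp add: Un_absorb2 Int_commute)

lemma signed_measures_linear:
  assumes "\<nu> \<in> signed_measures" "\<rho> \<in> signed_measures"
  shows "(\<lambda>A. a * \<nu> A + b * \<rho> A) \<in> signed_measures"
  using assms by (auto simp: signed_measures_def intro!: sums_add sums_mult)

lemma signed_measures_uminus:
  assumes "\<nu> \<in> signed_measures"
  shows "(\<lambda>A. - \<nu> A) \<in> signed_measures"
  using assms by (auto simp: signed_measures_def intro!: sums_minus)

lemma sets_pos_part [measurable_cong]: "sets (pos_part \<nu>) = sets half_line"
  using sets.sets_measure_of_eq[of half_line] by (simp add: pos_part_def space_restrict_space)

lemma space_pos_part: "space (pos_part \<nu>) = {0..}"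
  using sets_eq_imp_space_eq[OF sets_pos_part] by (simp add: space_restrict_space)

lemma sigma_algebra_half_line: "sigma_algebra {0..} (sets half_line)"
  using sets.sigma_algebra_axioms[of half_line] by (simp add: space_restrict_space)

text \<open>
  The supremum defining the positive part is superadditive, because sets nearly attaining it in
  disjoint sets can be united, and countably subadditive, because a subset of a disjoint union splits
  into its traces.  Hence it is a measure and \<^const>\<open>measure_of\<close> does not collapse to the zero measure.
\<close>

lemma emeasure_pos_part:
  assumes \<nu>: "\<nu> \<in> signed_measures" and A: "A \<in> sets half_line"
  shows "emeasure (pos_part \<nu>) A = (SUP B \<in> {B \<in> sets half_line. B \<subseteq> A}. ennreal (\<nu> B))"
  unfolding pos_part_def
proof (rule emeasure_measure_of_sigma[OF sigma_algebra_half_line _ _ A])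
  define P where "P A = (SUP B \<in> {B \<in> sets half_line. B \<subseteq> A}. ennreal (\<nu> B))" for A
  have P_ge: "ennreal (\<nu> B) \<le> P A" if "B \<in> sets half_line" "B \<subseteq> A" for A B
    unfolding P_def by (rule SUP_upper) (use that in auto)
  have P_mono: "P A \<le> P B" if "A \<subseteq> B" for A B
    unfolding P_def by (rule SUP_subset_mono) (use that in auto)
  have "{B \<in> sets half_line. B \<subseteq> {}} = {{}}" by auto
  then have P_empty: "P {} = 0"
    using signed_measure_empty[OF \<nu>] by (simp add: P_def)
  have P_super: "P A + P B \<le> P (A \<union> B)"
    if AB: "A \<inter> B = {}" for A B
  proof -
    have *: "ennreal (\<nu> C) + ennreal (\<nu> D) \<le> P (A \<union> B)"
      if "C \<in> sets half_line" "C \<subseteq> A" "D \<in> sets half_line" "D \<subseteq> B" for C D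
    proof -
      \<comment> \<open>Conversion to \<^typ>\<open>ennreal\<close> truncates negative values; passing to the empty set makes it additive.\<close>
      have **: "\<exists>C'. C' \<in> sets half_line \<and> C' \<subseteq> C \<and> ennreal (\<nu> C) = ennreal (\<nu> C') \<and> 0 \<le> \<nu> C'"
        if "C \<in> sets half_line" for C
        using that signed_measure_empty[OF \<nu>]
        by (intro exI[of _ "if 0 \<le> \<nu> C then C else {}"]) (simp add: ennreal_neg)
      obtain C' D' where CD: "C' \<in> sets half_line" "C' \<subseteq> C" "ennreal (\<nu> C) = ennreal (\<nu> C')" "0 \<le> \<nu> C'"
        "D' \<in> sets half_line" "D' \<subseteq> D" "ennreal (\<nu> D) = ennreal (\<nu> D')" "0 \<le> \<nu> D'"
        using **[of C] **[of D] \<open>C \<in> _\<close> \<open>D \<in> _\<close> by blast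
      have "\<nu> (C' \<union> D') = \<nu> C' + \<nu> D'"
        using CD \<open>C \<subseteq> A\<close> \<open>D \<subseteq> B\<close> AB by (intro signed_measure_Un[OF \<nu>]) blast+
      then have "ennreal (\<nu> C) + ennreal (\<nu> D) = ennreal (\<nu> (C' \<union> D'))"
        using CD by (simp add: ennreal_plus)
      also have "\<dots> \<le> P (A \<union> B)"
        using CD that by (intro P_ge) auto
      finally show ?thesis .
    qed
    have ne: "{C \<in> sets half_line. C \<subseteq> A} \<noteq> {}" "{C \<in> sets half_line. C \<subseteq> B} \<noteq> {}" by auto
    have "P A + P B = (SUP C \<in> {C \<in> sets half_line. C \<subseteq> A}. ennreal (\<nu> C) + P B)"
      unfolding P_def[of A] using ennreal_SUP_add_left[OF ne(1)] by simp
    also have "\<dots> \<le> P (A \<union> B)"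
    proof (rule SUP_least)
      fix C assume C: "C \<in> {C \<in> sets half_line. C \<subseteq> A}"
      have "ennreal (\<nu> C) + P B = (SUP D \<in> {C \<in> sets half_line. C \<subseteq> B}. ennreal (\<nu> C) + ennreal (\<nu> D))"
        unfolding P_def[of B] using ennreal_SUP_add_right[OF ne(2)] by simp
      also have "\<dots> \<le> P (A \<union> B)"
        using * C by (intro SUP_least) auto
      finally show "ennreal (\<nu> C) + P B \<le> P (A \<union> B)" .
    qed
    finally show ?thesis .
  qed
  show "positive (sets half_line) P"
    using P_empty by (simp add: positive_def)
  show "countably_additive (sets half_line) P"
  proof (rule countably_additiveI)
    fix A :: "nat \<Rightarrow> real set"
    assume A: "range A \<subseteq> sets half_line" and disj: "disjoint_family A"
    have fin: "(\<Sum>i<n. P (A i)) \<le> P (\<Union>i<n. A i)" for n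
    proof (induction n)
      case (Suc n)
      have "(\<Sum>i<Suc n. P (A i)) \<le> P (\<Union>i<n. A i) + P (A n)"
        using Suc by (simp add: add_right_mono)
      also have "\<dots> \<le> P ((\<Union>i<n. A i) \<union> A n)"
      proof (rule P_super)
        have "A i \<inter> A n = {}" if "i < n" for i
          using disj that unfolding disjoint_family_on_def by (metis UNIV_I less_irrefl)
        then show "(\<Union>i<n. A i) \<inter> A n = {}" by blast
      qed
      also have "(\<Union>i<n. A i) \<union> A n = (\<Union>i<Suc n. A i)"
        by (auto simp: less_Suc_eq)
      finally show ?case .
    qed (simp add: P_empty)
    have "(\<Sum>i. P (A i)) \<le> P (\<Union>i. A i)"
    proof (rule suminf_le_const)
      fix n
      have "(\<Sum>i<n. P (A i)) \<le> P (\<Union>i<n. A i)" by (rule fin)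
      also have "\<dots> \<le> P (\<Union>i. A i)" by (rule P_mono) auto
      finally show "(\<Sum>i<n. P (A i)) \<le> P (\<Union>i. A i)" .
    qed auto
    moreover have "P (\<Union>i. A i) \<le> (\<Sum>i. P (A i))"
      unfolding P_def[of "\<Union>i. A i"]
    proof (rule SUP_least)
      fix B assume B: "B \<in> {B \<in> sets half_line. B \<subseteq> (\<Union>i. A i)}"
      have "(\<lambda>n. \<nu> (B \<inter> A n)) sums \<nu> (\<Union>n. B \<inter> A n)"
        using A B disj by (intro signed_measure_sums[OF \<nu>]) (auto simp: disjoint_family_on_def)
      moreover have "(\<Union>n. B \<inter> A n) = B" using B by auto
      ultimately have "(\<lambda>n. ennreal (\<Sum>i<n. \<nu> (B \<inter> A i))) \<longlonglongrightarrow> ennreal (\<nu> B)"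
        by (auto simp: sums_def intro!: tendsto_ennrealI)
      moreover have "ennreal (\<Sum>i<n. \<nu> (B \<inter> A i)) \<le> (\<Sum>i. P (A i))" for n
      proof -
        have "ennreal (\<Sum>i<n. \<nu> (B \<inter> A i)) \<le> ennreal (\<Sum>i<n. max 0 (\<nu> (B \<inter> A i)))"
          by (intro ennreal_leI sum_mono) auto
        also have "\<dots> = (\<Sum>i<n. ennreal (max 0 (\<nu> (B \<inter> A i))))"
          by (intro sum_ennreal[symmetric]) auto
        also have "\<dots> \<le> (\<Sum>i<n. P (A i))"
          using A B P_ge[of "B \<inter> A _"] by (intro sum_mono) (auto simp: max_def ennreal_neg)
        also have "\<dots> \<le> (\<Sum>i. P (A i))"
          by (intro sum_le_suminf) auto
        finally show ?thesis .
      qed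
      ultimately show "ennreal (\<nu> B) \<le> (\<Sum>i. P (A i))"
        by (intro LIMSEQ_le_const2) auto
    qed
    ultimately show "(\<Sum>i. P (A i)) = P (\<Union>i. A i)" by (rule antisym)
  qed
qed

lemma sets_neg_part [measurable_cong]: "sets (neg_part \<nu>) = sets half_line"
  unfolding neg_part_def by (rule sets_pos_part)

lemma space_neg_part: "space (neg_part \<nu>) = {0..}"
  unfolding neg_part_def by (rule space_pos_part)

lemma sets_variation [measurable_cong]: "sets (variation \<nu>) = sets half_line"
  using sets.sets_measure_of_eq[of half_line] by (simp add: variation_def space_restrict_space)

lemma space_variation: "space (variation \<nu>) = {0..}"
  using sets_eq_imp_space_eq[OF sets_variation] by (simp add: space_restrict_space)

lemma emeasure_variation:
  assumes A: "A \<in> sets half_line"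
  shows "emeasure (variation \<nu>) A = emeasure (pos_part \<nu>) A + emeasure (neg_part \<nu>) A"
  unfolding variation_def
proof (rule emeasure_measure_of_sigma[OF sigma_algebra_half_line _ _ A])
  show "positive (sets half_line) (\<lambda>A. emeasure (pos_part \<nu>) A + emeasure (neg_part \<nu>) A)"
    by (simp add: positive_def)
  show "countably_additive (sets half_line) (\<lambda>A. emeasure (pos_part \<nu>) A + emeasure (neg_part \<nu>) A)"
    by (rule countably_additiveI)
       (simp add: suminf_add[symmetric] suminf_emeasure sets_pos_part sets_neg_part)
qed

text \<open>
  A real-valued countably additive set function is bounded.  If the variation of \<open>E\<close> is infinite, some
  \<open>B \<subseteq> E\<close> has \<open>\<bar>\<nu> B\<bar> > 1 + \<bar>\<nu> E\<bar>\<close>, so that \<open>\<bar>\<nu> B\<bar>\<close> and \<open>\<bar>\<nu> (E - B)\<bar>\<close> both exceed \<open>1\<close>, while one of \<open>B\<close>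
  and \<open>E - B\<close> has again infinite variation.  Keeping that part and cutting off the other one forever
  gives disjoint sets with \<open>\<bar>\<nu>\<bar> > 1\<close>, whose values cannot form a convergent series.
\<close>

lemma finite_variation:
  assumes \<nu>: "\<nu> \<in> signed_measures"
  shows "emeasure (variation \<nu>) {0..} \<noteq> \<infinity>"
proof
  assume top: "emeasure (variation \<nu>) {0..} = \<infinity>"
  have half_sets: "{0..} \<in> sets half_line"
    using sets.top[of half_line] by (simp add: space_restrict_space)
  have large: "\<exists>B. B \<in> sets half_line \<and> B \<subseteq> E \<and> c < \<bar>\<nu> B\<bar>"
    if E: "E \<in> sets half_line" "emeasure (variation \<nu>) E = \<infinity>" and c: "0 \<le> c" for E c
  proof (rule ccontr)
    assume "\<not> ?thesis"
    then have *: "\<nu> B \<le> c" "- \<nu> B \<le> c" if "B \<in> sets half_line" "B \<subseteq> E" for B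
      using that by (meson not_le abs_le_iff)+
    have "emeasure (pos_part \<nu>) E \<le> ennreal c"
      unfolding emeasure_pos_part[OF \<nu> E(1)] by (intro SUP_least ennreal_leI *) simp_all
    moreover have "emeasure (neg_part \<nu>) E \<le> ennreal c"
      unfolding neg_part_def emeasure_pos_part[OF signed_measures_uminus[OF \<nu>] E(1)]
      by (intro SUP_least ennreal_leI *) simp_all
    ultimately have "emeasure (variation \<nu>) E \<le> ennreal c + ennreal c"
      unfolding emeasure_variation[OF E(1)] by (rule add_mono)
    then show False using E(2) by (simp add: top_unique)
  qed
  have split: "\<exists>B. B \<in> sets half_line \<and> B \<subseteq> E \<and> emeasure (variation \<nu>) B = \<infinity> \<and> 1 < \<bar>\<nu> (E - B)\<bar>"
    if E: "E \<in> sets half_line" "emeasure (variation \<nu>) E = \<infinity>" for E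
  proof -
    obtain B where B: "B \<in> sets half_line" "B \<subseteq> E" "1 + \<bar>\<nu> E\<bar> < \<bar>\<nu> B\<bar>"
      using large[OF E, of "1 + \<bar>\<nu> E\<bar>"] by auto
    have diff: "\<nu> (E - B) = \<nu> E - \<nu> B"
      using signed_measure_Diff[OF \<nu> E(1) B(1,2)] .
    have EB: "E - (E - B) = B" using B by auto
    have "emeasure (variation \<nu>) B + emeasure (variation \<nu>) (E - B) = \<infinity>"
      using plus_emeasure[of B "variation \<nu>" "E - B"] B E
      by (simp add: sets_variation Un_absorb1)
    then consider "emeasure (variation \<nu>) B = \<infinity>" | "emeasure (variation \<nu>) (E - B) = \<infinity>"
      by (metis ennreal_add_eq_top infinity_ennreal_def)
    then show ?thesis
    proof cases
      case 1
      then show ?thesis using B diff by (intro exI[of _ B]) auto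
    next
      case 2
      then show ?thesis using B diff E EB by (intro exI[of _ "E - B"]) auto
    qed
  qed
  obtain E :: "nat \<Rightarrow> real set" where E: "\<And>n. E n \<in> sets half_line"
    "\<And>n. E (Suc n) \<subseteq> E n" "\<And>n. 1 < \<bar>\<nu> (E n - E (Suc n))\<bar>"
  proof -
    have "\<exists>E. \<forall>n::nat. (E n \<in> sets half_line \<and> emeasure (variation \<nu>) (E n) = \<infinity>) \<and>
        (E (Suc n) \<subseteq> E n \<and> 1 < \<bar>\<nu> (E n - E (Suc n))\<bar>)"
      by (rule dependent_nat_choice) (use half_sets top split in blast)+
    then show ?thesis using that by blast
  qed
  have anti: "E n \<subseteq> E m" if "m \<le> n" for m n
    using that E(2) by (rule lift_Suc_antimono_le[rotated])
  have "disjoint_family (\<lambda>n. E n - E (Suc n))"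
    unfolding disjoint_family_on_def
  proof (intro ballI impI)
    fix m n :: nat assume "m \<noteq> n"
    then consider "Suc m \<le> n" | "Suc n \<le> m" by linarith
    then show "(E m - E (Suc m)) \<inter> (E n - E (Suc n)) = {}"
      by cases (use anti in blast)+
  qed
  then have "(\<lambda>n. \<nu> (E n - E (Suc n))) sums \<nu> (\<Union>n. E n - E (Suc n))"
    using E(1) by (intro signed_measure_sums[OF \<nu>]) auto
  then have "(\<lambda>n. \<nu> (E n - E (Suc n))) \<longlonglongrightarrow> 0"
    using sums_summable summable_LIMSEQ_zero by blast
  then have "\<forall>\<^sub>F n in sequentially. \<bar>\<nu> (E n - E (Suc n))\<bar> < 1"
    using tendstoD[of _ 0 _ 1] by fastforce
  then show False
    using E(3) by (auto simp: eventually_sequentially) (meson le_refl less_asym)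
qed

lemma half_line_in_sets [simp]: "{0..} \<in> sets half_line"
  using sets.top[of half_line] by (simp add: space_restrict_space)

lemma finite_measure_pos_part:
  assumes "\<nu> \<in> signed_measures"
  shows "finite_measure (pos_part \<nu>)"
  using finite_variation[OF assms] emeasure_variation[OF half_line_in_sets, of \<nu>]
  by (intro finite_measureI) (simp add: space_pos_part)

lemma finite_measure_neg_part:
  assumes "\<nu> \<in> signed_measures"
  shows "finite_measure (neg_part \<nu>)"
  unfolding neg_part_def by (rule finite_measure_pos_part[OF signed_measures_uminus[OF assms]])

lemma finite_measure_variation:
  assumes "\<nu> \<in> signed_measures"
  shows "finite_measure (variation \<nu>)"
  using finite_variation[OF assms] by (intro finite_measureI) (simp add: space_variation)

text \<open>
  Complementation \<open>B \<mapsto> A - B\<close> turns the supremum of \<open>\<nu>\<close> over subsets of \<open>A\<close> into the supremum of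
  \<open>\<nu> A + (- \<nu>)\<close>.
\<close>

lemma Jordan_decomposition:
  assumes \<nu>: "\<nu> \<in> signed_measures" and A: "A \<in> sets half_line"
  shows "\<nu> A = measure (pos_part \<nu>) A - measure (neg_part \<nu>) A"
proof -
  interpret P: finite_measure "pos_part \<nu>" by (rule finite_measure_pos_part[OF \<nu>])
  interpret Q: finite_measure "neg_part \<nu>" by (rule finite_measure_neg_part[OF \<nu>])
  have P: "\<nu> B \<le> measure (pos_part \<nu>) A" if "B \<in> sets half_line" "B \<subseteq> A" for B
  proof -
    have "ennreal (\<nu> B) \<le> emeasure (pos_part \<nu>) A"
      unfolding emeasure_pos_part[OF \<nu> A] by (rule SUP_upper) (use that in auto)
    then show ?thesis by (simp add: P.emeasure_eq_measure)
  qed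
  have Q: "- \<nu> B \<le> measure (neg_part \<nu>) A" if "B \<in> sets half_line" "B \<subseteq> A" for B
  proof -
    have "ennreal (- \<nu> B) \<le> emeasure (neg_part \<nu>) A"
      unfolding neg_part_def emeasure_pos_part[OF signed_measures_uminus[OF \<nu>] A]
      by (rule SUP_upper) (use that in auto)
    then show ?thesis by (simp add: Q.emeasure_eq_measure)
  qed
  have diff: "\<nu> (A - B) = \<nu> A - \<nu> B" if "B \<in> sets half_line" "B \<subseteq> A" for B
    using signed_measure_Diff[OF \<nu> A that] .
  have "emeasure (pos_part \<nu>) A \<le> ennreal (measure (neg_part \<nu>) A + \<nu> A)"
    unfolding emeasure_pos_part[OF \<nu> A]
  proof (intro SUP_least ennreal_leI)
    fix B assume B: "B \<in> {B \<in> sets half_line. B \<subseteq> A}"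
    then show "\<nu> B \<le> measure (neg_part \<nu>) A + \<nu> A"
      using Q[of "A - B"] A diff[of B] by auto
  qed
  moreover have "0 \<le> measure (neg_part \<nu>) A + \<nu> A"
    using Q[of A] A by simp
  ultimately have 1: "measure (pos_part \<nu>) A \<le> measure (neg_part \<nu>) A + \<nu> A"
    by (simp add: P.emeasure_eq_measure)
  have "emeasure (neg_part \<nu>) A \<le> ennreal (measure (pos_part \<nu>) A - \<nu> A)"
    unfolding neg_part_def emeasure_pos_part[OF signed_measures_uminus[OF \<nu>] A]
  proof (intro SUP_least ennreal_leI)
    fix B assume B: "B \<in> {B \<in> sets half_line. B \<subseteq> A}"
    then show "- \<nu> B \<le> measure (pos_part \<nu>) A - \<nu> A"
      using P[of "A - B"] A diff[of B] by auto
  qed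
  moreover have "0 \<le> measure (pos_part \<nu>) A - \<nu> A"
    using P[of A] A by simp
  ultimately have "measure (neg_part \<nu>) A \<le> measure (pos_part \<nu>) A - \<nu> A"
    by (simp add: Q.emeasure_eq_measure)
  with 1 show ?thesis by simp
qed

section \<open>Linearity of the integral\<close>

text \<open>
  Only the values on \<open>[0,\<infinity>)\<close> are constrained, as test functions are arbitrary on the negative numbers.
\<close>

definition bounded_borel :: "(real \<Rightarrow> real) \<Rightarrow> bool" where
  "bounded_borel \<phi> \<longleftrightarrow> \<phi> \<in> borel_measurable half_line \<and> (\<exists>B. \<forall>x\<ge>0. \<bar>\<phi> x\<bar> \<le> B)"

lemma bounded_borelI:
  assumes "\<phi> \<in> borel_measurable half_line" "\<And>x. 0 \<le> x \<Longrightarrow> \<bar>\<phi> x\<bar> \<le> B"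
  shows "bounded_borel \<phi>"
  using assms by (auto simp: bounded_borel_def)

lemma bounded_borel_continuous:
  assumes "continuous_on {0..} \<phi>" "\<And>x. 0 \<le> x \<Longrightarrow> \<bar>\<phi> x\<bar> \<le> B"
  shows "bounded_borel \<phi>"
  using assms by (intro bounded_borelI borel_measurable_continuous_on_restrict)

lemma bounded_borel_const: "bounded_borel (\<lambda>x. c)"
  by (rule bounded_borelI) auto

lemma bounded_borel_integrable:
  assumes "finite_measure M" "sets M = sets half_line" "bounded_borel \<phi>"
  shows "integrable M \<phi>"
proof -
  obtain B where B: "\<phi> \<in> borel_measurable half_line" "\<And>x. x \<ge> 0 \<Longrightarrow> \<bar>\<phi> x\<bar> \<le> B"
    using assms(3) by (auto simp: bounded_borel_def)
  have "space M = {0..}"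
    using sets_eq_imp_space_eq[OF assms(2)] by (simp add: space_restrict_space)
  moreover have "\<phi> \<in> borel_measurable M"
    using B(1) measurable_cong_sets[OF assms(2) refl] by blast
  ultimately show ?thesis
    using B(2) by (intro finite_measure.integrable_const_bound[OF assms(1), of _ B]) (auto intro!: AE_I2)
qed

lemma signed_integral_fun_linear:
  assumes \<nu>: "\<nu> \<in> signed_measures" and "bounded_borel \<phi>" "bounded_borel \<psi>"
  shows "signed_integral \<nu> (\<lambda>x. a * \<phi> x + b * \<psi> x) = a * signed_integral \<nu> \<phi> + b * signed_integral \<nu> \<psi>"
  unfolding signed_integral_def
  using bounded_borel_integrable[OF finite_measure_pos_part[OF \<nu>] sets_pos_part assms(2)]
    bounded_borel_integrable[OF finite_measure_pos_part[OF \<nu>] sets_pos_part assms(3)]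
    bounded_borel_integrable[OF finite_measure_neg_part[OF \<nu>] sets_neg_part assms(2)]
    bounded_borel_integrable[OF finite_measure_neg_part[OF \<nu>] sets_neg_part assms(3)]
  by (simp add: algebra_simps)

lemma signed_integral_cong:
  assumes "\<And>x. 0 \<le> x \<Longrightarrow> \<phi> x = \<psi> x"
  shows "signed_integral \<nu> \<phi> = signed_integral \<nu> \<psi>"
  unfolding signed_integral_def
  by (intro arg_cong2[where f = "(-)"] Bochner_Integration.integral_cong)
     (auto simp: space_pos_part space_neg_part assms)

lemma signed_integral_indicator:
  assumes \<nu>: "\<nu> \<in> signed_measures" and A: "A \<in> sets half_line"
  shows "signed_integral \<nu> (indicator A) = \<nu> A"
proof -
  have "A \<subseteq> {0..}"
    using sets.sets_into_space[OF A] by (simp add: space_restrict_space)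
  then show ?thesis
    using Jordan_decomposition[OF \<nu> A] A
    by (simp add: signed_integral_def space_pos_part space_neg_part Int_absorb1 Int_absorb2)
qed

lemma signed_integral_bounded_convergence:
  assumes \<nu>: "\<nu> \<in> signed_measures"
    and U: "\<And>i::nat. U i \<in> borel_measurable half_line" "\<And>i x. 0 \<le> x \<Longrightarrow> \<bar>U i x\<bar> \<le> B"
    and lim: "\<And>x. 0 \<le> x \<Longrightarrow> (\<lambda>i. U i x) \<longlonglongrightarrow> \<phi> x"
    and \<phi>: "\<phi> \<in> borel_measurable half_line"
  shows "(\<lambda>i. signed_integral \<nu> (U i)) \<longlonglongrightarrow> signed_integral \<nu> \<phi>"
proof -
  have *: "(\<lambda>i. integral\<^sup>L M (U i)) \<longlonglongrightarrow> integral\<^sup>L M \<phi>"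
    if M: "finite_measure M" "sets M = sets half_line" for M
  proof (rule integral_dominated_convergence[where w = "\<lambda>_. B"])
    have sp: "space M = {0..}"
      using sets_eq_imp_space_eq[OF M(2)] by (simp add: space_restrict_space)
    show "\<phi> \<in> borel_measurable M" "U i \<in> borel_measurable M" for i
      using \<phi> U(1) measurable_cong_sets[OF M(2) refl] by blast+
    show "integrable M (\<lambda>_. B)"
      by (rule bounded_borel_integrable[OF M bounded_borel_const])
    show "AE x in M. (\<lambda>i. U i x) \<longlonglongrightarrow> \<phi> x" "AE x in M. norm (U i x) \<le> B" for i
      using lim U(2) by (auto intro!: AE_I2 simp: sp)
  qed
  show ?thesis
    unfolding signed_integral_def
    by (intro tendsto_diff * finite_measure_pos_part finite_measure_neg_part \<nu> sets_pos_part sets_neg_part)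
qed

text \<open>
  The Jordan parts of \<open>a \<nu> + b \<rho>\<close> are not combinations of those of \<open>\<nu>\<close> and \<open>\<rho>\<close>, so linearity cannot be
  read off the definition.  It holds for indicators, where the integral is the value of the set
  function, and passes to monotone limits of simple functions.
\<close>

lemma signed_integral_measure_linear_nonneg:
  assumes \<nu>: "\<nu> \<in> signed_measures" and \<rho>: "\<rho> \<in> signed_measures"
    and u: "u \<in> borel_measurable half_line" "\<And>x. 0 \<le> u x" and bdd: "\<And>x. 0 \<le> x \<Longrightarrow> u x \<le> B"
  shows "signed_integral (\<lambda>A. a * \<nu> A + b * \<rho> A) u = a * signed_integral \<nu> u + b * signed_integral \<rho> u"
proof -
  note sum = signed_measures_linear[OF \<nu> \<rho>, of a b]
  from u bdd show ?thesis
  proof (induction arbitrary: B rule: borel_measurable_induct_real)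
    case (set A)
    then show ?case
      by (simp add: signed_integral_indicator[OF \<nu>] signed_integral_indicator[OF \<rho>]
          signed_integral_indicator[OF sum])
  next
    case (mult u c)
    show ?case
    proof (cases "c = 0")
      case True
      then show ?thesis by (simp add: signed_integral_def)
    next
      case False
      with \<open>0 \<le> c\<close> have c: "c > 0" by simp
      then have ub: "u x \<le> B / c" if "x \<ge> 0" for x
        using mult.prems[OF that] by (simp add: field_simps)
      then have "bounded_borel u"
        using mult.hyps by (intro bounded_borelI[of _ "B / c"]) auto
      then have *: "signed_integral \<nu>' (\<lambda>x. c * u x) = c * signed_integral \<nu>' u"
        if "\<nu>' \<in> signed_measures" for \<nu>'
        using signed_integral_fun_linear[OF that, of u u c 0] by simp
      show ?thesis
        using mult.IH[OF ub] by (simp add: * \<nu> \<rho> sum algebra_simps)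
    qed
  next
    case (add u v)
    have ub: "u x \<le> B" "v x \<le> B" if "x \<ge> 0" for x
      using add.prems[OF that] add.hyps(2)[of x] add.hyps(4)[of x] by linarith+
    have bb: "bounded_borel u" "bounded_borel v"
      using add.hyps ub by (auto intro!: bounded_borelI[of _ B])
    have *: "signed_integral \<nu>' (\<lambda>x. v x + u x) = signed_integral \<nu>' v + signed_integral \<nu>' u"
      if "\<nu>' \<in> signed_measures" for \<nu>'
      using signed_integral_fun_linear[OF that bb(2) bb(1), of 1 1] by simp
    show ?case
      using add.IH(1)[OF ub(1)] add.IH(2)[OF ub(2)]
      unfolding *[OF \<nu>] *[OF \<rho>] *[OF sum] by (simp add: algebra_simps)
  next
    case (seq U)
    have "U i x \<le> u x" if "0 \<le> x" for i x
    proof (rule incseq_le)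
      show "incseq (\<lambda>i. U i x)"
        using \<open>incseq U\<close> by (auto simp: incseq_def le_fun_def)
      show "(\<lambda>i. U i x) \<longlonglongrightarrow> u x"
        using seq.hyps that by (auto simp: space_restrict_space)
    qed
    then have ub: "U i x \<le> B" if "0 \<le> x" for i x
      using seq.prems[OF that] that order_trans by blast
    have um: "u \<in> borel_measurable half_line"
      using seq.hyps by (intro borel_measurable_LIMSEQ_real[of half_line U u]) auto
    have *: "(\<lambda>i. signed_integral \<nu>' (U i)) \<longlonglongrightarrow> signed_integral \<nu>' u"
      if "\<nu>' \<in> signed_measures" for \<nu>'
      using seq.hyps ub um
      by (intro signed_integral_bounded_convergence[OF that, of U B]) (auto simp: space_restrict_space)
    have "(\<lambda>i. a * signed_integral \<nu> (U i) + b * signed_integral \<rho> (U i)) \<longlonglongrightarrow>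
        a * signed_integral \<nu> u + b * signed_integral \<rho> u"
      by (intro tendsto_intros * \<nu> \<rho>)
    moreover have "(\<lambda>i. a * signed_integral \<nu> (U i) + b * signed_integral \<rho> (U i)) =
        (\<lambda>i. signed_integral (\<lambda>A. a * \<nu> A + b * \<rho> A) (U i))"
      using seq.IH[OF ub] by simp
    ultimately show ?case
      using LIMSEQ_unique[OF *[OF sum]] by simp
  qed
qed

lemma signed_integral_measure_linear:
  assumes \<nu>: "\<nu> \<in> signed_measures" and \<rho>: "\<rho> \<in> signed_measures" and \<phi>: "bounded_borel \<phi>"
  shows "signed_integral (\<lambda>A. a * \<nu> A + b * \<rho> A) \<phi> = a * signed_integral \<nu> \<phi> + b * signed_integral \<rho> \<phi>"
proof -
  note sum = signed_measures_linear[OF \<nu> \<rho>, of a b]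
  obtain B where B: "\<phi> \<in> borel_measurable half_line" "\<And>x. x \<ge> 0 \<Longrightarrow> \<bar>\<phi> x\<bar> \<le> B"
    using \<phi> by (auto simp: bounded_borel_def)
  define u where "u x = max 0 (\<phi> x + B)" for x
  have u: "u \<in> borel_measurable half_line" "\<And>x. 0 \<le> u x"
    using B(1) by (simp_all add: u_def[abs_def])
  have u_le: "u x \<le> 2 * B" if "0 \<le> x" for x
    using B(2)[OF that] by (simp add: u_def)
  have bu: "bounded_borel u"
    using u u_le by (intro bounded_borelI[of _ "2 * B"]) auto
  have one: "signed_integral (\<lambda>A. a * \<nu> A + b * \<rho> A) (\<lambda>_. 1) =
      a * signed_integral \<nu> (\<lambda>_. 1) + b * signed_integral \<rho> (\<lambda>_. 1)"
    by (rule signed_integral_measure_linear_nonneg[OF \<nu> \<rho>, of _ 1]) auto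
  have shift: "signed_integral \<nu>' \<phi> = signed_integral \<nu>' u - B * signed_integral \<nu>' (\<lambda>_. 1)"
    if "\<nu>' \<in> signed_measures" for \<nu>'
  proof -
    have "signed_integral \<nu>' \<phi> = signed_integral \<nu>' (\<lambda>x. 1 * u x + (- B) * 1)"
      using B(2) by (intro signed_integral_cong) (force simp: u_def)
    then show ?thesis
      using signed_integral_fun_linear[OF that bu bounded_borel_const, of 1 "- B" 1] by simp
  qed
  show ?thesis
    using signed_integral_measure_linear_nonneg[OF \<nu> \<rho> u u_le] one
    by (simp add: shift \<nu> \<rho> sum algebra_simps)
qed

section \<open>The bounded-Lipschitz norm\<close>

lemma signed_integral_bound:
  assumes \<nu>: "\<nu> \<in> signed_measures" and \<phi>: "bounded_borel \<phi>" and B: "\<And>x. 0 \<le> x \<Longrightarrow> \<bar>\<phi> x\<bar> \<le> B"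
  shows "\<bar>signed_integral \<nu> \<phi>\<bar> \<le> B * (measure (pos_part \<nu>) {0..} + measure (neg_part \<nu>) {0..})"
proof -
  have *: "\<bar>integral\<^sup>L M \<phi>\<bar> \<le> B * measure M {0..}" if M: "finite_measure M" "sets M = sets half_line" for M
  proof -
    have sp: "space M = {0..}"
      using sets_eq_imp_space_eq[OF M(2)] by (simp add: space_restrict_space)
    have "\<bar>integral\<^sup>L M \<phi>\<bar> \<le> (LINT x|M. \<bar>\<phi> x\<bar>)"
      by (rule integral_abs_bound)
    also have "\<dots> \<le> (LINT x|M. B)"
      using B by (intro integral_mono integrable_abs bounded_borel_integrable[OF M] \<phi> bounded_borel_const)
        (auto simp: sp)
    also have "\<dots> = B * measure M {0..}"
      by (simp add: sp)
    finally show ?thesis .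
  qed
  show ?thesis
    using *[OF finite_measure_pos_part[OF \<nu>] sets_pos_part] *[OF finite_measure_neg_part[OF \<nu>] sets_neg_part]
    unfolding signed_integral_def ring_distribs by linarith
qed

text \<open>
  The supremum is one of reals, so it bounds its members only because the integrals of functions
  bounded by \<open>1\<close> are bounded by the total variation.
\<close>

lemma bl_norm_upper:
  assumes \<nu>: "\<nu> \<in> signed_measures" and lip: "1-lipschitz_on {0..} \<phi>" and bd: "\<And>x. 0 \<le> x \<Longrightarrow> \<bar>\<phi> x\<bar> \<le> 1"
  shows "signed_integral \<nu> \<phi> \<le> bl_norm \<nu>"
  unfolding bl_norm_def
proof (rule cSup_upper)
  have cont: "continuous_on {0..} \<phi>"
    using lip by (rule lipschitz_on_continuous_on)
  have "integrable (variation \<nu>) \<phi>"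
    using bounded_borel_continuous[OF cont bd]
    by (intro bounded_borel_integrable finite_measure_variation[OF \<nu>] sets_variation)
  then show "signed_integral \<nu> \<phi> \<in> {signed_integral \<nu> \<phi> |\<phi>. continuous_on {0..} \<phi> \<and>
      integrable (variation \<nu>) \<phi> \<and> (\<forall>x\<ge>0. \<bar>\<phi> x\<bar> \<le> 1) \<and> 1-lipschitz_on {0..} \<phi>}"
    using cont lip bd by (intro CollectI exI[of _ \<phi>]) simp
  show "bdd_above {signed_integral \<nu> \<phi> |\<phi>. continuous_on {0..} \<phi> \<and>
      integrable (variation \<nu>) \<phi> \<and> (\<forall>x\<ge>0. \<bar>\<phi> x\<bar> \<le> 1) \<and> 1-lipschitz_on {0..} \<phi>}"
  proof (rule bdd_aboveI, safe)
    fix \<psi> :: "real \<Rightarrow> real" assume \<psi>: "continuous_on {0..} \<psi>" "\<forall>x\<ge>0. \<bar>\<psi> x\<bar> \<le> (1::real)"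
    have "bounded_borel \<psi>"
      by (rule bounded_borel_continuous[OF \<psi>(1), of 1]) (use \<psi>(2) in simp)
    then have "\<bar>signed_integral \<nu> \<psi>\<bar> \<le> 1 * (measure (pos_part \<nu>) {0..} + measure (neg_part \<nu>) {0..})"
      by (rule signed_integral_bound[OF \<nu>]) (use \<psi>(2) in simp)
    then show "signed_integral \<nu> \<psi> \<le> 1 * (measure (pos_part \<nu>) {0..} + measure (neg_part \<nu>) {0..})"
      by linarith
  qed
qed

lemma bl_norm_least:
  assumes "\<And>\<phi>. 1-lipschitz_on {0..} \<phi> \<Longrightarrow> (\<And>x. 0 \<le> x \<Longrightarrow> \<bar>\<phi> x\<bar> \<le> 1) \<Longrightarrow> signed_integral \<nu> \<phi> \<le> c"
  shows "bl_norm \<nu> \<le> c"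
  unfolding bl_norm_def
proof (rule cSup_least)
  have "signed_integral \<nu> (\<lambda>_. 0) \<in> {signed_integral \<nu> \<phi> |\<phi>. continuous_on {0..} \<phi> \<and>
      integrable (variation \<nu>) \<phi> \<and> (\<forall>x\<ge>0. \<bar>\<phi> x\<bar> \<le> 1) \<and> 1-lipschitz_on {0..} \<phi>}"
    by (intro CollectI exI[of _ "\<lambda>_. 0"]) (simp add: lipschitz_on_def)
  then show "{signed_integral \<nu> \<phi> |\<phi>. continuous_on {0..} \<phi> \<and>
      integrable (variation \<nu>) \<phi> \<and> (\<forall>x\<ge>0. \<bar>\<phi> x\<bar> \<le> 1) \<and> 1-lipschitz_on {0..} \<phi>} \<noteq> {}"
    unfolding ex_in_conv[symmetric] by (rule exI)
next
  fix y assume "y \<in> {signed_integral \<nu> \<phi> |\<phi>. continuous_on {0..} \<phi> \<and>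
      integrable (variation \<nu>) \<phi> \<and> (\<forall>x\<ge>0. \<bar>\<phi> x\<bar> \<le> 1) \<and> 1-lipschitz_on {0..} \<phi>}"
  then obtain \<phi> where "y = signed_integral \<nu> \<phi>" "\<forall>x\<ge>0. \<bar>\<phi> x\<bar> \<le> 1" "1-lipschitz_on {0..} \<phi>"
    by (elim CollectE exE conjE)
  then show "y \<le> c"
    using assms[of \<phi>] by simp
qed

lemma bl_norm_lipschitz:
  assumes \<nu>: "\<nu> \<in> signed_measures" and B: "0 < B"
    and lip: "\<And>x y. 0 \<le> x \<Longrightarrow> 0 \<le> y \<Longrightarrow> \<bar>f x - f y\<bar> \<le> B * \<bar>x - y\<bar>"
    and bd: "\<And>x. 0 \<le> x \<Longrightarrow> \<bar>f x\<bar> \<le> B"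
  shows "\<bar>signed_integral \<nu> f\<bar> \<le> B * bl_norm \<nu>"
proof -
  have Blip: "B-lipschitz_on {0..} f"
    using B lip by (auto simp: lipschitz_on_def dist_real_def)
  have bf: "bounded_borel f"
    using bounded_borel_continuous[OF lipschitz_on_continuous_on[OF Blip] bd] .
  have *: "c * signed_integral \<nu> f \<le> bl_norm \<nu>" if c: "\<bar>c\<bar> = 1 / B" for c
  proof -
    have "signed_integral \<nu> (\<lambda>x. c * f x) \<le> bl_norm \<nu>"
    proof (rule bl_norm_upper[OF \<nu>])
      have "\<bar>c * f x - c * f y\<bar> \<le> \<bar>x - y\<bar>" if "0 \<le> x" "0 \<le> y" for x y
      proof -
        have "\<bar>c * f x - c * f y\<bar> = \<bar>c\<bar> * \<bar>f x - f y\<bar>"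
          by (simp add: abs_mult[symmetric] right_diff_distrib)
        also have "\<dots> \<le> \<bar>x - y\<bar>"
          unfolding c using lip[OF that] B by (simp add: field_simps)
        finally show ?thesis .
      qed
      then show "1-lipschitz_on {0..} (\<lambda>x. c * f x)"
        by (auto simp: lipschitz_on_def dist_real_def)
      show "\<bar>c * f x\<bar> \<le> 1" if "0 \<le> x" for x
        using bd[OF that] B by (simp add: abs_mult c field_simps)
    qed
    then show ?thesis
      using signed_integral_fun_linear[OF \<nu> bf bf, of c 0] by simp
  qed
  have "signed_integral \<nu> f / B \<le> bl_norm \<nu>" "- (signed_integral \<nu> f / B) \<le> bl_norm \<nu>"
    using *[of "1 / B"] *[of "- (1 / B)"] B by (simp_all add: abs_of_pos)
  then show ?thesis
    using B by (simp add: field_simps abs_le_iff)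
qed

lemma bl_norm_diff:
  assumes \<nu>: "\<nu> \<in> signed_measures" and \<rho>: "\<rho> \<in> signed_measures"
    and close: "bl_norm (\<lambda>A. \<nu> A - \<rho> A) \<le> \<epsilon>" and B: "0 < B"
    and lip: "\<And>x y. 0 \<le> x \<Longrightarrow> 0 \<le> y \<Longrightarrow> \<bar>f x - f y\<bar> \<le> B * \<bar>x - y\<bar>"
    and bd: "\<And>x. 0 \<le> x \<Longrightarrow> \<bar>f x\<bar> \<le> B"
  shows "\<bar>signed_integral \<nu> f - signed_integral \<rho> f\<bar> \<le> B * \<epsilon>"
proof -
  have "B-lipschitz_on {0..} f"
    using B lip by (auto simp: lipschitz_on_def dist_real_def)
  then have f: "bounded_borel f"
    by (intro bounded_borel_continuous[OF lipschitz_on_continuous_on bd])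
  have eq: "(\<lambda>A. 1 * \<nu> A + (- 1) * \<rho> A) = (\<lambda>A. \<nu> A - \<rho> A)" by simp
  have "\<bar>signed_integral (\<lambda>A. \<nu> A - \<rho> A) f\<bar> \<le> B * bl_norm (\<lambda>A. \<nu> A - \<rho> A)"
    using signed_measures_linear[OF \<nu> \<rho>, of 1 "- 1"] unfolding eq
    by (intro bl_norm_lipschitz B lip bd)
  also have "\<dots> \<le> B * \<epsilon>"
    using close B by (intro mult_left_mono) auto
  finally show ?thesis
    using signed_integral_measure_linear[OF \<nu> \<rho> f, of 1 "- 1"] unfolding eq by simp
qed

section \<open>Non-negative measures and their supports\<close>

lemma nonneg_signed: "\<nu> \<in> nonneg_measures \<Longrightarrow> \<nu> \<in> signed_measures"
  by (simp add: nonneg_measures_def)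

lemma emeasure_neg_part_nonneg:
  assumes \<nu>: "\<nu> \<in> nonneg_measures" and A: "A \<in> sets half_line"
  shows "emeasure (neg_part \<nu>) A = 0"
  unfolding neg_part_def emeasure_pos_part[OF signed_measures_uminus[OF nonneg_signed[OF \<nu>]] A]
proof -
  have "ennreal (- \<nu> B) \<le> 0" for B
    using \<nu> by (simp add: nonneg_measures_def ennreal_neg)
  then show "(SUP B\<in>{B \<in> sets half_line. B \<subseteq> A}. ennreal (- \<nu> B)) = 0"
    by (metis (no_types, lifting) SUP_least bot.extremum_uniqueI bot_ennreal)
qed

lemma variation_nonneg:
  assumes \<nu>: "\<nu> \<in> nonneg_measures"
  shows "variation \<nu> = pos_part \<nu>"
proof (rule measure_eqI)
  show "sets (variation \<nu>) = sets (pos_part \<nu>)"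
    by (simp add: sets_variation sets_pos_part)
  show "emeasure (variation \<nu>) A = emeasure (pos_part \<nu>) A" if "A \<in> sets (variation \<nu>)" for A
    using that by (simp add: sets_variation emeasure_variation emeasure_neg_part_nonneg[OF \<nu>])
qed

lemma signed_integral_nonneg_measure:
  assumes \<nu>: "\<nu> \<in> nonneg_measures"
  shows "signed_integral \<nu> \<phi> = (LINT x|pos_part \<nu>. \<phi> x)"
proof -
  have "{0..} \<in> null_sets (neg_part \<nu>)"
    using emeasure_neg_part_nonneg[OF \<nu> half_line_in_sets] by (intro null_setsI) (simp_all add: sets_neg_part)
  then have "AE x in neg_part \<nu>. \<phi> x = 0"
    by (rule AE_I') (auto simp: space_neg_part)
  then show ?thesis
    by (simp add: signed_integral_def integral_eq_zero_AE)
qed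

lemma measure_pos_part_nonneg:
  assumes \<nu>: "\<nu> \<in> nonneg_measures" and A: "A \<in> sets half_line"
  shows "measure (pos_part \<nu>) A = \<nu> A"
  using Jordan_decomposition[OF nonneg_signed[OF \<nu>] A] emeasure_neg_part_nonneg[OF \<nu> A]
  by (simp add: measure_def)

lemma measure_in_nonneg_measures:
  assumes M: "finite_measure M" "sets M = sets half_line"
  shows "measure M \<in> nonneg_measures"
  using finite_measure.finite_measure_UNION[OF M(1)] M(2)
  by (auto simp: nonneg_measures_def signed_measures_def measure_notin_sets)

lemma pos_part_measure:
  assumes M: "finite_measure M" "sets M = sets half_line"
  shows "pos_part (measure M) = M"
proof (rule measure_eqI)
  interpret P: finite_measure "pos_part (measure M)"
    by (intro finite_measure_pos_part nonneg_signed measure_in_nonneg_measures M)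
  show "sets (pos_part (measure M)) = sets M"
    by (simp add: sets_pos_part M)
  show "emeasure (pos_part (measure M)) A = emeasure M A" if "A \<in> sets (pos_part (measure M))" for A
    using measure_pos_part_nonneg[OF measure_in_nonneg_measures[OF M], of A] that
    by (simp add: sets_pos_part P.emeasure_eq_measure finite_measure.emeasure_eq_measure[OF M(1)])
qed

lemma half_line_Int: "A \<in> sets borel \<Longrightarrow> A \<inter> {0..} \<in> sets half_line"
  by (simp add: sets_restrict_space_iff)

lemma finite_measure_return: "0 \<le> a \<Longrightarrow> finite_measure (return half_line a)"
  by (intro finite_measureI) (simp add: space_restrict_space)

lemma dirac_nonneg: "0 \<le> a \<Longrightarrow> dirac a \<in> nonneg_measures"
  unfolding dirac_def by (rule measure_in_nonneg_measures[OF finite_measure_return]) auto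

lemma signed_integral_dirac:
  assumes "0 \<le> a" "bounded_borel \<phi>"
  shows "signed_integral (dirac a) \<phi> = \<phi> a"
proof -
  have "pos_part (dirac a) = return half_line a"
    unfolding dirac_def by (intro pos_part_measure finite_measure_return assms) simp
  then have "signed_integral (dirac a) \<phi> = (LINT x|return half_line a. \<phi> x)"
    using assms by (simp add: signed_integral_nonneg_measure dirac_nonneg)
  also have "\<dots> = \<phi> a"
    using assms by (intro integral_return) (auto simp: bounded_borel_def space_restrict_space)
  finally show ?thesis .
qed

text \<open>
  Every point outside the support has a null neighbourhood; by Lindelof countably many of them cover
  the complement of the support.
\<close>

lemma AE_supp:
  assumes \<nu>: "\<nu> \<in> nonneg_measures"
  shows "AE x in pos_part \<nu>. x \<in> supp \<nu>"
proof -
  define \<F> where "\<F> = {U. open U \<and> emeasure (variation \<nu>) (U \<inter> {0..}) = 0}"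
  obtain \<F>' where F': "\<F>' \<subseteq> \<F>" "countable \<F>'" "\<Union>\<F>' = \<Union>\<F>"
    by (rule Lindelof[of \<F>]) (auto simp: \<F>_def)
  have "U \<inter> {0..} \<in> null_sets (pos_part \<nu>)" if "U \<in> \<F>'" for U
  proof (rule null_setsI)
    show "emeasure (pos_part \<nu>) (U \<inter> {0..}) = 0"
      using that F'(1) by (auto simp: \<F>_def variation_nonneg[OF \<nu>])
    show "U \<inter> {0..} \<in> sets (pos_part \<nu>)"
      using that F'(1) by (intro subsetD[OF equalityD2[OF sets_pos_part]] half_line_Int) (auto simp: \<F>_def)
  qed
  then have "(\<Union>U\<in>\<F>'. U \<inter> {0..}) \<in> null_sets (pos_part \<nu>)"
    by (rule null_sets_UN'[OF F'(2)])
  then show ?thesis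
  proof (rule AE_I')
    show "{x \<in> space (pos_part \<nu>). x \<notin> supp \<nu>} \<subseteq> (\<Union>U\<in>\<F>'. U \<inter> {0..})"
    proof
      fix x assume x: "x \<in> {x \<in> space (pos_part \<nu>). x \<notin> supp \<nu>}"
      then obtain U where "open U" "x \<in> U" "\<not> 0 < emeasure (variation \<nu>) (U \<inter> {0..})" "0 \<le> x"
        by (auto simp: supp_def space_pos_part)
      then have "U \<in> \<F>"
        by (auto simp: \<F>_def zero_less_iff_neq_zero)
      then have "x \<in> \<Union>\<F>'"
        using F'(3) \<open>x \<in> U\<close> by auto
      then show "x \<in> (\<Union>U\<in>\<F>'. U \<inter> {0..})"
        using \<open>0 \<le> x\<close> by auto
    qed
  qed
qed

section \<open>Elementary inequalities\<close>

lemma powr_diff_le: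
  fixes \<gamma> :: real
  assumes \<gamma>: "0 < \<gamma>" and l: "0 \<le> l" and D: "\<And>\<xi>. l < \<xi> \<Longrightarrow> \<xi> < L \<Longrightarrow> \<xi> powr (\<gamma> - 1) \<le> D"
    and x: "x \<in> {l..L}" and y: "y \<in> {l..L}"
  shows "\<bar>x powr \<gamma> - y powr \<gamma>\<bar> \<le> \<gamma> * D * \<bar>x - y\<bar>"
proof -
  have *: "\<bar>b powr \<gamma> - a powr \<gamma>\<bar> \<le> \<gamma> * D * \<bar>b - a\<bar>" if ab: "a < b" "l \<le> a" "b \<le> L" for a b
  proof -
    obtain \<xi> where \<xi>: "\<xi> \<in> {a<..<b}" "b powr \<gamma> - a powr \<gamma> = \<gamma> * \<xi> powr (\<gamma> - 1) * (b - a)"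
    proof (rule mvt[of a b "\<lambda>x. x powr \<gamma>" "\<lambda>\<xi> h. \<gamma> * \<xi> powr (\<gamma> - 1) * h"])
      show "continuous_on {a..b} (\<lambda>x. x powr \<gamma>)"
        using \<gamma> l ab by (intro continuous_on_powr' continuous_intros) auto
      show "((\<lambda>x. x powr \<gamma>) has_derivative (*) (\<gamma> * \<xi> powr (\<gamma> - 1))) (at \<xi>)" if "a < \<xi>" "\<xi> < b" for \<xi>
        using that l ab has_real_derivative_powr[of \<xi> \<gamma>] by (simp add: has_field_derivative_def)
    qed (use ab that in auto)
    have "0 \<le> \<gamma> * \<xi> powr (\<gamma> - 1)" "\<gamma> * \<xi> powr (\<gamma> - 1) \<le> \<gamma> * D"
      using D[of \<xi>] \<xi>(1) ab \<gamma> by auto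
    then show ?thesis
      unfolding \<xi>(2) using ab by (simp add: abs_mult mult_right_mono)
  qed
  show ?thesis
    using *[of x y] *[of y x] x y by (cases x y rule: linorder_cases) (auto simp: abs_minus_commute)
qed

text \<open>
  The upper bound for \<open>e\<^sup>-\<^sup>s\<close> comes from \<open>1 + s \<le> e\<^sup>s\<close> and \<open>(1 - s + s\<^sup>2) (1 + s) = 1 + s\<^sup>3 \<ge> 1\<close>.
\<close>

lemma exp_minus_second_order:
  fixes s :: real
  assumes "0 \<le> s"
  shows "\<bar>1 - exp (- s) - s\<bar> \<le> s\<^sup>2"
proof -
  have "1 \<le> (1 - s + s\<^sup>2) * (1 + s)"
    using assms by (simp add: algebra_simps power2_eq_square)
  also have "\<dots> \<le> (1 - s + s\<^sup>2) * exp s"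
  proof (rule mult_left_mono[OF exp_ge_add_one_self])
    have "0 \<le> (1 - s)\<^sup>2" by simp
    then show "0 \<le> 1 - s + s\<^sup>2" using assms by (simp add: power2_eq_square algebra_simps)
  qed
  finally have "exp (- s) \<le> 1 - s + s\<^sup>2"
    by (simp add: exp_minus field_simps)
  then show ?thesis
    using exp_ge_add_one_self[of "- s"] by (simp add: abs_le_iff)
qed

lemma abs_set_integral_le:
  fixes f :: "real \<Rightarrow> real"
  assumes t: "0 \<le> t" and f: "set_integrable lborel {0..t} f"
    and le: "AE s in lborel. s \<in> {0..t} \<longrightarrow> \<bar>f s\<bar> \<le> K"
  shows "\<bar>LINT s:{0..t}|lborel. f s\<bar> \<le> K * t"
proof -
  have "\<bar>LINT s:{0..t}|lborel. f s\<bar> \<le> (LINT s|lborel. \<bar>indicator {0..t} s *\<^sub>R f s\<bar>)"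
    unfolding set_lebesgue_integral_def by (rule integral_abs_bound)
  also have "\<dots> \<le> (LINT s|lborel. indicator {0..t} s *\<^sub>R K)"
  proof (rule integral_mono_AE)
    show "AE s in lborel. \<bar>indicator {0..t} s *\<^sub>R f s\<bar> \<le> indicator {0..t} s *\<^sub>R K"
      using le by eventually_elim (auto simp: indicator_def)
    show "integrable lborel (\<lambda>s. \<bar>indicator {0..t} s *\<^sub>R f s\<bar>)"
      using f unfolding set_integrable_def by (rule integrable_abs)
    show "integrable lborel (\<lambda>s. indicator {0..t} s *\<^sub>R K)"
      unfolding set_integrable_def[symmetric]
      by (intro borel_integrable_atLeastAtMost' continuous_intros)
  qed
  also have "\<dots> = K * t"
    using t by simp
  finally show ?thesis .
qed

text \<open>
  Let \<open>E\<close> be the maximum of \<open>m(t) e\<^sup>-\<^sup>2\<^sup>b\<^sup>t\<close>, attained at \<open>u\<close>.  Inserting \<open>m(s) \<le> E e\<^sup>2\<^sup>b\<^sup>s\<close> into the integral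
  inequality at \<open>u\<close> gives \<open>E \<le> m\<^sub>0 + E / 2\<close>.  The factor \<open>2\<close> lost against the sharp inequality only
  affects constants.
\<close>

lemma Gronwall_integral:
  fixes m :: "real \<Rightarrow> real"
  assumes b: "0 < b" and T: "0 \<le> T" and cont: "continuous_on {0..T} m" and m0: "0 \<le> m0"
    and le: "\<And>t. 0 \<le> t \<Longrightarrow> t \<le> T \<Longrightarrow> m t \<le> m0 + (LINT s:{0..t}|lborel. b * m s)"
    and t: "0 \<le> t" "t \<le> T"
  shows "m t \<le> 2 * m0 * exp (2 * b * t)"
proof -
  have "continuous_on {0..T} (\<lambda>t. m t * exp (- (2 * b * t)))"
    by (intro continuous_intros cont)
  then obtain u where u: "u \<in> {0..T}" "\<And>s. s \<in> {0..T} \<Longrightarrow> m s * exp (- (2 * b * s)) \<le> m u * exp (- (2 * b * u))"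
    using continuous_attains_sup[of "{0..T}" "\<lambda>t. m t * exp (- (2 * b * t))"] T by auto
  define E where "E = m u * exp (- (2 * b * u))"
  have mE: "m s \<le> E * exp (2 * b * s)" if "s \<in> {0..T}" for s
    using u(2)[OF that] by (simp add: E_def exp_minus field_simps)
  have int1: "set_integrable lborel {0..u} (\<lambda>s. b * m s)"
    using u(1) by (intro borel_integrable_atLeastAtMost' continuous_intros continuous_on_subset[OF cont]) auto
  have int2: "set_integrable lborel {0..u} (\<lambda>s. b * (E * exp (2 * b * s)))"
    by (intro borel_integrable_atLeastAtMost' continuous_intros)
  have "m u \<le> m0 + (LINT s:{0..u}|lborel. b * m s)"
    using le u(1) by auto
  also have "(LINT s:{0..u}|lborel. b * m s) \<le> (LINT s:{0..u}|lborel. b * (E * exp (2 * b * s)))"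
    using u(1) b by (intro set_integral_mono int1 int2 mult_left_mono mE) auto
  also have "\<dots> = E / 2 * exp (2 * b * u) - E / 2 * exp (2 * b * 0)"
    unfolding set_lebesgue_integral_def
  proof (rule integral_FTC_Icc)
    show "((\<lambda>s. E / 2 * exp (2 * b * s)) has_vector_derivative b * (E * exp (2 * b * x))) (at x within {0..u})" for x
      unfolding has_real_derivative_iff_has_vector_derivative[symmetric]
      by (auto intro!: derivative_eq_intros)
  qed (use u(1) in \<open>auto intro!: continuous_intros\<close>)
  finally have *: "m u \<le> m0 + E / 2 * exp (2 * b * u) - E / 2"
    by simp
  have mu: "m u = E * exp (2 * b * u)"
    by (simp add: E_def exp_minus field_simps)
  have E: "E \<le> 2 * m0"
  proof (rule ccontr)
    assume "\<not> E \<le> 2 * m0"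
    then have "m0 < E / 2" by simp
    then have "0 < E" using m0 by simp
    then have "E / 2 \<le> E / 2 * exp (2 * b * u)"
      using b u(1) by simp
    with * \<open>m0 < E / 2\<close> \<open>0 < E\<close> show False
      unfolding mu by linarith
  qed
  have "m t \<le> E * exp (2 * b * t)" using mE t by auto
  also have "\<dots> \<le> 2 * m0 * exp (2 * b * t)"
    using E by (intro mult_right_mono) auto
  finally show ?thesis .
qed

lemma at_most_linear:
  assumes "\<bar>y\<bar> \<le> B" "0 \<le> (x::real)"
  shows "\<bar>y\<bar> \<le> B * (1 + x)"
proof -
  have "0 \<le> B" using assms by linarith
  then have "0 \<le> B * x" using assms by simp
  with assms show ?thesis unfolding distrib_left by linarith
qed

section \<open>The dual fragmentation operator\<close>

locale fragmentation_operator =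
  fixes \<alpha> \<gamma> :: real and \<kappa> :: "real set \<Rightarrow> real" and N :: real
  assumes \<alpha>: "0 < \<alpha>" and \<gamma>: "0 < \<gamma>" and kernel: "frag_kernel N \<kappa>"
begin

lemma \<kappa>_nonneg: "\<kappa> \<in> nonneg_measures"
  using kernel by (simp add: frag_kernel_def)

lemma \<kappa>_signed: "\<kappa> \<in> signed_measures"
  by (rule nonneg_signed[OF \<kappa>_nonneg])

definition kernel_integral :: "(real \<Rightarrow> real) \<Rightarrow> real" where
  "kernel_integral h = signed_integral \<kappa> (\<lambda>z. indicator {0..1} z * h z)"

lemma kernel_integral_one: "kernel_integral (\<lambda>_. 1) = N"
  using kernel by (simp add: frag_kernel_def kernel_integral_def)

lemma kernel_integral_ident: "kernel_integral (\<lambda>z. z) = 1"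
  using kernel by (simp add: frag_kernel_def kernel_integral_def)

lemma bounded_borel_cutoff:
  assumes h: "continuous_on {0..1} h"
  shows "bounded_borel (\<lambda>z. indicator {0..1} z * h z)"
proof -
  have "bounded (h ` {0..1})"
    by (intro compact_imp_bounded compact_continuous_image h) auto
  then obtain B where B: "\<And>z. z \<in> {0..1} \<Longrightarrow> \<bar>h z\<bar> \<le> B"
    unfolding bounded_iff real_norm_def by blast
  have "0 \<le> B" using B[of 0] by auto
  have "(\<lambda>z. indicator {0..1} z *\<^sub>R h z) \<in> borel_measurable borel"
    by (intro borel_measurable_continuous_on_indicator h) auto
  then have "(\<lambda>z. indicator {0..1} z * h z) \<in> borel_measurable half_line"
    by (auto intro: measurable_restrict_space1)
  then show ?thesis
    using B \<open>0 \<le> B\<close> by (intro bounded_borelI[of _ B]) (auto simp: indicator_def)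
qed

lemma kernel_integral_linear:
  assumes "continuous_on {0..1} h" "continuous_on {0..1} g"
  shows "kernel_integral (\<lambda>z. a * h z + b * g z) = a * kernel_integral h + b * kernel_integral g"
  using signed_integral_fun_linear[OF \<kappa>_signed bounded_borel_cutoff[OF assms(1)] bounded_borel_cutoff[OF assms(2)], of a b]
  by (simp add: kernel_integral_def algebra_simps)

text \<open>
  The two moments \<open>\<integral> d\<kappa> = N\<close> and \<open>\<integral> z d\<kappa> = 1\<close> integrate any affine majorant; all bounds on the gain
  term below are of this form.
\<close>

lemma kernel_integral_le:
  assumes h: "continuous_on {0..1} h" and le: "\<And>z. 0 \<le> z \<Longrightarrow> z \<le> 1 \<Longrightarrow> h z \<le> a + b * z"
  shows "kernel_integral h \<le> a * N + b"
proof -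
  have "kernel_integral h \<le> kernel_integral (\<lambda>z. a * 1 + b * z)"
    unfolding kernel_integral_def signed_integral_nonneg_measure[OF \<kappa>_nonneg]
  proof (rule integral_mono)
    show "integrable (pos_part \<kappa>) (\<lambda>z. indicator {0..1} z * h z)"
      "integrable (pos_part \<kappa>) (\<lambda>z. indicator {0..1} z * (a * 1 + b * z))"
      by (intro bounded_borel_integrable finite_measure_pos_part \<kappa>_signed sets_pos_part
          bounded_borel_cutoff h continuous_intros)+
    show "indicator {0..1} z * h z \<le> indicator {0..1} z * (a * 1 + b * z)" for z
      using le[of z] by (simp add: indicator_def)
  qed
  also have "\<dots> = a * N + b"
    using kernel_integral_linear[of "\<lambda>_. 1" "\<lambda>z. z" a b]
    by (simp add: kernel_integral_one kernel_integral_ident continuous_on_id)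
  finally show ?thesis .
qed

lemma kernel_integral_abs_le:
  assumes h: "continuous_on {0..1} h" and le: "\<And>z. 0 \<le> z \<Longrightarrow> z \<le> 1 \<Longrightarrow> \<bar>h z\<bar> \<le> a + b * z"
  shows "\<bar>kernel_integral h\<bar> \<le> a * N + b"
proof -
  have "kernel_integral h \<le> a * N + b"
    using le by (intro kernel_integral_le h) (simp add: abs_le_iff)
  moreover have "- kernel_integral h = kernel_integral (\<lambda>z. - h z)"
    using kernel_integral_linear[OF h h, of "-1" 0] by simp
  moreover have "kernel_integral (\<lambda>z. - h z) \<le> a * N + b"
    using le by (intro kernel_integral_le continuous_intros h) (simp add: abs_le_iff)
  ultimately show ?thesis by linarith
qed

lemma kernel_mass_ge_one: "1 \<le> N"
  using kernel_integral_le[of "\<lambda>z. z" 1 0] by (simp add: kernel_integral_ident continuous_on_id)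

lemma kernel_integral_eq:
  assumes "continuous_on {0..} \<phi>" "\<And>x. 0 \<le> x \<Longrightarrow> \<bar>\<phi> x\<bar> \<le> B"
  shows "kernel_integral \<phi> = signed_integral \<kappa> \<phi>"
  unfolding kernel_integral_def signed_integral_nonneg_measure[OF \<kappa>_nonneg]
proof (rule integral_cong_AE)
  have *: "\<psi> \<in> borel_measurable (pos_part \<kappa>)" if "bounded_borel \<psi>" for \<psi>
    using bounded_borel_integrable[OF finite_measure_pos_part[OF \<kappa>_signed] sets_pos_part that] by simp
  show "\<phi> \<in> borel_measurable (pos_part \<kappa>)"
    by (rule *[OF bounded_borel_continuous[OF assms]])
  show "(\<lambda>z. indicator {0..1} z * \<phi> z) \<in> borel_measurable (pos_part \<kappa>)"
    by (intro * bounded_borel_cutoff continuous_on_subset[OF assms(1)]) auto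
  show "AE z in pos_part \<kappa>. indicator {0..1} z * \<phi> z = \<phi> z"
    using AE_supp[OF \<kappa>_nonneg]
  proof eventually_elim
    case (elim z)
    moreover have "supp \<kappa> \<subseteq> {0..1}" using kernel by (simp add: frag_kernel_def)
    ultimately show ?case by (auto simp: indicator_def)
  qed
qed

abbreviation A :: "(real \<Rightarrow> real) \<Rightarrow> real \<Rightarrow> real" where
  "A \<equiv> frag_dual \<alpha> \<gamma> \<kappa>"

lemma A_eq: "A \<phi> x = \<alpha> * x powr \<gamma> * (kernel_integral (\<lambda>z. \<phi> (x * z)) - \<phi> x)"
  by (simp add: frag_dual_def kernel_integral_def)

lemma continuous_on_dilation:
  fixes x :: real
  assumes "continuous_on {0..x} \<phi>" "0 \<le> x"
  shows "continuous_on {0..1} (\<lambda>z. \<phi> (x * z))"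
proof (rule continuous_on_compose2[OF assms(1)])
  show "continuous_on {0..1} (\<lambda>z. x * z)"
    by (rule linear_continuous_on[OF bounded_linear_mult_right])
  show "(\<lambda>z. x * z) ` {0..1} \<subseteq> {0..x}"
    using assms(2) by (auto simp: mult_left_le)
qed

lemma A_le:
  assumes "0 \<le> x" and \<phi>: "continuous_on {0..x} \<phi>"
    and le: "\<And>z. 0 \<le> z \<Longrightarrow> z \<le> 1 \<Longrightarrow> \<phi> (x * z) \<le> a + b * z"
  shows "A \<phi> x \<le> \<alpha> * x powr \<gamma> * (a * N + b - \<phi> x)"
  unfolding A_eq using \<alpha> assms kernel_integral_le[OF continuous_on_dilation[OF \<phi>] le]
  by (intro mult_left_mono) auto

lemma A_abs_le:
  assumes "0 \<le> x" and \<phi>: "continuous_on {0..x} \<phi>"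
    and bd: "\<And>y. 0 \<le> y \<Longrightarrow> y \<le> x \<Longrightarrow> \<bar>\<phi> y\<bar> \<le> B"
  shows "\<bar>A \<phi> x\<bar> \<le> \<alpha> * x powr \<gamma> * ((1 + N) * B)"
proof -
  have "\<bar>\<phi> (x * z)\<bar> \<le> B + 0 * z" if "0 \<le> z" "z \<le> 1" for z
    using that \<open>0 \<le> x\<close> by (auto intro!: bd mult_left_le)
  then have "\<bar>kernel_integral (\<lambda>z. \<phi> (x * z))\<bar> \<le> B * N + 0"
    by (intro kernel_integral_abs_le continuous_on_dilation assms)
  moreover have "\<bar>\<phi> x\<bar> \<le> B" using bd assms by simp
  ultimately have "\<bar>kernel_integral (\<lambda>z. \<phi> (x * z)) - \<phi> x\<bar> \<le> (1 + N) * B"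
    by (simp add: algebra_simps)
  then show ?thesis
    unfolding A_eq abs_mult using \<alpha> by (intro mult_mono) auto
qed

text \<open>
  Fragments are smaller than their parent: for \<open>z \<in> [0,1]\<close> the excess of \<open>x z\<close> over \<open>L\<close> is at most \<open>z\<close>
  times the excess of \<open>x\<close>, and \<open>\<integral> z d\<kappa> = 1\<close>.
\<close>

lemma A_excess_nonpos:
  assumes "0 \<le> L" "0 \<le> x"
  shows "A (\<lambda>x. max 0 (x - L)) x \<le> 0"
proof -
  have "max 0 (x * z - L) \<le> 0 + max 0 (x - L) * z" if "0 \<le> z" "z \<le> 1" for z
  proof -
    have "x * z - L \<le> (x - L) * z"
      using that assms by (simp add: algebra_simps mult_left_le)
    also have "\<dots> \<le> max 0 (x - L) * z"
      using that by (intro mult_right_mono) auto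
    finally show ?thesis
      using that by auto
  qed
  then have "A (\<lambda>x. max 0 (x - L)) x \<le> \<alpha> * x powr \<gamma> * (0 * N + max 0 (x - L) - max 0 (x - L))"
    by (intro A_le assms continuous_intros)
  then show ?thesis by simp
qed

text \<open>
  The exponent is at least \<open>2 \<gamma>\<close>, to control the remainder of the second-order expansion, and at least
  \<open>1\<close>, so that fragmentation does not increase the moment of this order.  The cut-off at \<open>L\<close> makes the
  function an admissible test function.
\<close>

definition weight :: "real \<Rightarrow> real \<Rightarrow> real" where
  "weight L x = 1 + min x L powr max 1 (2 * \<gamma>)"

lemma weight_continuous: "0 \<le> L \<Longrightarrow> continuous_on {0..} (weight L)"
  unfolding weight_def by (intro continuous_intros continuous_on_powr') (auto simp: min_def)

lemma powr_le_weight: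
  assumes "0 \<le> p" "p \<le> 2 * \<gamma>" "0 \<le> x" "x \<le> L"
  shows "x powr p \<le> weight L x"
proof (cases "x \<le> 1")
  case True
  then have "x powr p \<le> 1"
    using assms by (simp add: powr_le1)
  also have "\<dots> \<le> weight L x"
    by (simp add: weight_def)
  finally show ?thesis .
next
  case False
  then have "x powr p \<le> x powr max 1 (2 * \<gamma>)"
    using assms by (intro powr_mono) auto
  then show ?thesis
    using assms by (simp add: weight_def)
qed

text \<open>
  Since \<open>p \<ge> 1\<close>, \<open>\<integral> (x z)\<^sup>p d\<kappa> \<le> x\<^sup>p\<close>: the power cancels against the loss term.  What remains is
  \<open>\<alpha> x\<^sup>\<gamma> (N - 1)\<close>, and \<open>x\<^sup>\<gamma>\<close> is again at most the weight.  The resulting rate \<open>\<alpha> N\<close> involves neither \<open>L\<close> nor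
  \<open>\<gamma>\<close>, as required of the constant in front of \<open>t\<close>.
\<close>

lemma A_weight_le:
  assumes x: "0 \<le> x" "x \<le> L"
  shows "A (weight L) x \<le> \<alpha> * N * weight L x"
proof -
  define p where "p = max 1 (2 * \<gamma>)"
  have p: "1 \<le> p" by (simp add: p_def)
  have w: "weight L y = 1 + y powr p" if "y \<le> x" for y
    using that x by (simp add: weight_def p_def)
  have "weight L (x * z) \<le> 1 + x powr p * z" if z: "0 \<le> z" "z \<le> 1" for z
  proof -
    have "z powr p \<le> z powr 1"
      using z p by (intro powr_mono') auto
    then have "z powr p \<le> z" using z by simp
    then show ?thesis
      using x z by (simp add: w mult_left_le powr_mult mult_left_mono)
  qed
  then have "A (weight L) x \<le> \<alpha> * x powr \<gamma> * (1 * N + x powr p - weight L x)"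
    using x by (intro A_le continuous_on_subset[OF weight_continuous]) auto
  also have "\<dots> = \<alpha> * x powr \<gamma> * (N - 1)"
    by (simp add: w)
  also have "\<dots> \<le> \<alpha> * weight L x * N"
  proof (rule mult_mono)
    have "0 \<le> weight L x" by (simp add: weight_def add_nonneg_nonneg)
    then show "0 \<le> \<alpha> * weight L x" using \<alpha> by simp
  qed (use \<alpha> \<gamma> kernel_mass_ge_one powr_le_weight[of \<gamma> x L] x in auto)
  finally show ?thesis by (simp add: algebra_simps)
qed

context
  fixes \<phi> :: "real \<Rightarrow> real"
  assumes lip: "1-lipschitz_on {0..} \<phi>" and bd: "\<And>x. 0 \<le> x \<Longrightarrow> \<bar>\<phi> x\<bar> \<le> 1"
begin

lemma \<phi>_continuous: "continuous_on {0..} \<phi>"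
  by (rule lipschitz_on_continuous_on[OF lip])

lemma dilation_continuous:
  assumes "0 \<le> x"
  shows "continuous_on {0..1} (\<lambda>z. \<phi> (x * z))"
  by (intro continuous_on_dilation assms continuous_on_subset[OF \<phi>_continuous]) auto

lemma lip_le: "0 \<le> x \<Longrightarrow> 0 \<le> y \<Longrightarrow> \<bar>\<phi> x - \<phi> y\<bar> \<le> \<bar>x - y\<bar>"
  using lipschitz_onD[OF lip, of x y] by (simp add: dist_real_def)

text \<open>
  Dilating by \<open>z\<close> multiplies the Lipschitz constant by \<open>z\<close>, and \<open>\<integral> z d\<kappa> = 1\<close>: the gain term has the same
  Lipschitz constant as \<open>\<phi>\<close>, whatever \<open>N\<close> is.
\<close>

lemma kernel_integral_dilation_lipschitz:
  assumes "0 \<le> x" "0 \<le> y"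
  shows "\<bar>kernel_integral (\<lambda>z. \<phi> (x * z)) - kernel_integral (\<lambda>z. \<phi> (y * z))\<bar> \<le> \<bar>x - y\<bar>"
proof -
  have "kernel_integral (\<lambda>z. \<phi> (x * z)) - kernel_integral (\<lambda>z. \<phi> (y * z)) =
      kernel_integral (\<lambda>z. \<phi> (x * z) - \<phi> (y * z))"
    using kernel_integral_linear[OF dilation_continuous[OF assms(1)] dilation_continuous[OF assms(2)], of 1 "-1"]
    by simp
  moreover have "\<bar>\<phi> (x * z) - \<phi> (y * z)\<bar> \<le> 0 + \<bar>x - y\<bar> * z" if "0 \<le> z" for z
    using lip_le[of "x * z" "y * z"] assms that by (simp add: left_diff_distrib[symmetric] abs_mult)
  then have "\<bar>kernel_integral (\<lambda>z. \<phi> (x * z) - \<phi> (y * z))\<bar> \<le> 0 * N + \<bar>x - y\<bar>"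
    by (intro kernel_integral_abs_le continuous_intros dilation_continuous assms)
  ultimately show ?thesis by simp
qed

lemma gain_minus_loss_lipschitz:
  assumes "0 \<le> x" "0 \<le> y"
  shows "\<bar>(kernel_integral (\<lambda>z. \<phi> (x * z)) - \<phi> x) - (kernel_integral (\<lambda>z. \<phi> (y * z)) - \<phi> y)\<bar> \<le> 2 * \<bar>x - y\<bar>"
  using abs_triangle_ineq4[of "kernel_integral (\<lambda>z. \<phi> (x * z)) - kernel_integral (\<lambda>z. \<phi> (y * z))" "\<phi> x - \<phi> y"]
    kernel_integral_dilation_lipschitz[OF assms] lip_le[OF assms]
  by (simp add: algebra_simps)

lemma A_continuous: "continuous_on {0..} (A \<phi>)"
proof -
  have "2-lipschitz_on {0..} (\<lambda>x. kernel_integral (\<lambda>z. \<phi> (x * z)) - \<phi> x)"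
    using gain_minus_loss_lipschitz by (auto simp: lipschitz_on_def dist_real_def)
  then have "continuous_on {0..} (\<lambda>x. kernel_integral (\<lambda>z. \<phi> (x * z)) - \<phi> x)"
    by (rule lipschitz_on_continuous_on)
  moreover have "continuous_on {0..} (\<lambda>x. x powr \<gamma>)"
    using \<gamma> by (intro continuous_on_powr' continuous_intros) auto
  ultimately show ?thesis
    unfolding A_eq[abs_def] by (intro continuous_on_mult continuous_on_const)
qed

lemma A_abs_le_powr:
  assumes "0 \<le> x"
  shows "\<bar>A \<phi> x\<bar> \<le> \<alpha> * (1 + N) * x powr \<gamma>"
proof -
  have "\<bar>A \<phi> x\<bar> \<le> \<alpha> * x powr \<gamma> * ((1 + N) * 1)"
    using bd assms by (intro A_abs_le continuous_on_subset[OF \<phi>_continuous]) auto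
  then show ?thesis by (simp add: algebra_simps)
qed

text \<open>
  Product rule for \<open>x\<^sup>\<gamma>\<close> and the difference of gain and loss, which is bounded by \<open>1 + N\<close> and
  \<open>2\<close>-Lipschitz.  The derivative of \<open>x\<^sup>\<gamma>\<close> may blow up at \<open>0\<close>, hence the bound \<open>D\<close> on an interval \<open>[l,L]\<close>.
\<close>

lemma A_lipschitz:
  assumes l: "0 \<le> l" and D: "\<And>\<xi>. l < \<xi> \<Longrightarrow> \<xi> < L \<Longrightarrow> \<xi> powr (\<gamma> - 1) \<le> D"
    and x: "x \<in> {l..L}" and y: "y \<in> {l..L}"
  shows "\<bar>A \<phi> x - A \<phi> y\<bar> \<le> \<alpha> * (2 * L powr \<gamma> + (1 + N) * (\<gamma> * D)) * \<bar>x - y\<bar>"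
proof -
  define \<psi> where "\<psi> x = kernel_integral (\<lambda>z. \<phi> (x * z)) - \<phi> x" for x
  have xy: "0 \<le> x" "0 \<le> y" "x \<le> L" "y \<le> L" using l x y by auto
  have "\<bar>kernel_integral (\<lambda>z. \<phi> (y * z))\<bar> \<le> 1 * N + 0"
    using xy by (intro kernel_integral_abs_le dilation_continuous) (auto intro!: bd)
  then have \<psi>_bd: "\<bar>\<psi> y\<bar> \<le> 1 + N"
    using bd[of y] xy by (simp add: \<psi>_def)
  have "\<bar>x powr \<gamma> * (\<psi> x - \<psi> y)\<bar> \<le> L powr \<gamma> * (2 * \<bar>x - y\<bar>)"
    unfolding abs_mult \<psi>_def using xy \<gamma> gain_minus_loss_lipschitz[OF xy(1,2)]
    by (intro mult_mono) (auto intro!: powr_mono2)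
  moreover have "\<bar>(x powr \<gamma> - y powr \<gamma>) * \<psi> y\<bar> \<le> (\<gamma> * D * \<bar>x - y\<bar>) * (1 + N)"
    unfolding abs_mult using powr_diff_le[OF \<gamma> l D x y] \<psi>_bd
    by (intro mult_mono) (auto intro: order_trans[OF abs_ge_zero])
  ultimately have "\<bar>x powr \<gamma> * (\<psi> x - \<psi> y) + (x powr \<gamma> - y powr \<gamma>) * \<psi> y\<bar> \<le>
      (2 * L powr \<gamma> + (1 + N) * (\<gamma> * D)) * \<bar>x - y\<bar>"
    by (simp add: algebra_simps)
  moreover have "A \<phi> x - A \<phi> y = \<alpha> * (x powr \<gamma> * (\<psi> x - \<psi> y) + (x powr \<gamma> - y powr \<gamma>) * \<psi> y)"
    by (simp add: A_eq \<psi>_def algebra_simps)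
  ultimately show ?thesis
    using \<alpha> by (simp add: abs_mult mult_left_mono mult.assoc)
qed

end

end

section \<open>Moments and short-time expansion of solutions\<close>

locale fragmentation_solution = fragmentation_operator +
  fixes \<mu>0 :: "real set \<Rightarrow> real" and \<mu> :: "real \<Rightarrow> real set \<Rightarrow> real" and L :: real
  assumes \<mu>0_nonneg: "\<mu>0 \<in> nonneg_measures" and \<mu>0_supp: "supp \<mu>0 \<subseteq> {0..L}" and L: "0 \<le> L"
    and solution: "nonneg_tv_solution \<alpha> \<gamma> \<kappa> \<mu>0 \<mu>"
begin

lemma \<mu>_nonneg: "0 \<le> t \<Longrightarrow> \<mu> t \<in> nonneg_measures"
  using solution by (simp add: nonneg_tv_solution_def)

lemma \<mu>_zero: "\<mu> 0 = \<mu>0"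
  using solution by (simp add: nonneg_tv_solution_def measure_solution_def)

text \<open>
  For a non-negative measure the variation is its positive part, so the integrability clauses concern
  the measures over which the integrals are taken.
\<close>

lemma weak_formulation:
  assumes \<phi>: "continuous_on {0..} \<phi>" "\<forall>x\<ge>0. \<bar>\<phi> x\<bar> \<le> C * (1 + x)" and t: "0 \<le> t"
  shows "integrable (pos_part (\<mu> t)) \<phi>"
    and "AE s in lborel. s \<in> {0..t} \<longrightarrow> integrable (pos_part (\<mu> s)) (A \<phi>)"
    and "set_integrable lborel {0..t} (\<lambda>s. signed_integral (\<mu> s) (A \<phi>))"
    and "signed_integral (\<mu> t) \<phi> = signed_integral \<mu>0 \<phi> +
             (LINT s:{0..t}|lborel. signed_integral (\<mu> s) (A \<phi>))"
proof -
  have "bounded ((\<lambda>x. \<phi> x / (1 + x)) ` {0..})"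
    unfolding bounded_iff using \<phi>(2) by (intro exI[of _ C]) (auto simp: abs_divide divide_le_eq)
  with \<phi>(1) t solution have *: "integrable (variation (\<mu> t)) \<phi> \<and>
           (AE s in lborel. s \<in> {0..t} \<longrightarrow> integrable (variation (\<mu> s)) (A \<phi>)) \<and>
           set_integrable lborel {0..t} (\<lambda>s. signed_integral (\<mu> s) (A \<phi>)) \<and>
           signed_integral (\<mu> t) \<phi> = signed_integral \<mu>0 \<phi> +
             (LINT s:{0..t}|lborel. signed_integral (\<mu> s) (A \<phi>))"
    by (simp add: nonneg_tv_solution_def measure_solution_def)
  then show "integrable (pos_part (\<mu> t)) \<phi>"
    using variation_nonneg[OF \<mu>_nonneg[OF t]] by simp
  have "AE s in lborel. s \<in> {0..t} \<longrightarrow> integrable (variation (\<mu> s)) (A \<phi>)"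
    using * by blast
  then show "AE s in lborel. s \<in> {0..t} \<longrightarrow> integrable (pos_part (\<mu> s)) (A \<phi>)"
    by eventually_elim (simp add: variation_nonneg[OF \<mu>_nonneg])
  show "set_integrable lborel {0..t} (\<lambda>s. signed_integral (\<mu> s) (A \<phi>))"
    and "signed_integral (\<mu> t) \<phi> = signed_integral \<mu>0 \<phi> +
             (LINT s:{0..t}|lborel. signed_integral (\<mu> s) (A \<phi>))"
    using * by blast+
qed

lemma \<mu>0_concentrated: "AE x in pos_part \<mu>0. x \<in> {0..L}"
  using AE_supp[OF \<mu>0_nonneg] by eventually_elim (use \<mu>0_supp in auto)

text \<open>
  Testing with the excess over \<open>L\<close>, which the dual operator does not increase: its integral starts at
  \<open>0\<close> and stays there.
\<close>

lemma \<mu>_concentrated: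
  assumes t: "0 \<le> t"
  shows "AE x in pos_part (\<mu> t). x \<in> {0..L}"
proof -
  define f where "f x = max 0 (x - L)" for x
  have f: "continuous_on {0..} f" "\<forall>x\<ge>0. \<bar>f x\<bar> \<le> 1 * (1 + x)"
    using L by (auto simp: f_def[abs_def] intro!: continuous_intros)
  note wf = weak_formulation[OF f t]
  have "signed_integral (\<mu> s) (A f) \<le> 0" if "0 \<le> s" for s
  proof -
    have "0 \<le> (LINT x|pos_part (\<mu> s). - A f x)"
      using A_excess_nonpos[OF L] unfolding f_def[abs_def]
      by (intro integral_nonneg_AE AE_I2) (simp add: space_pos_part)
    then show ?thesis
      by (simp add: signed_integral_nonneg_measure[OF \<mu>_nonneg[OF that]])
  qed
  then have "0 \<le> (LINT s:{0..t}|lborel. - signed_integral (\<mu> s) (A f))"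
    unfolding set_lebesgue_integral_def by (intro integral_nonneg_AE AE_I2) (auto simp: indicator_def)
  then have "(LINT s:{0..t}|lborel. signed_integral (\<mu> s) (A f)) \<le> 0"
    by (simp add: set_lebesgue_integral_def)
  moreover have "signed_integral \<mu>0 f = 0"
    unfolding signed_integral_nonneg_measure[OF \<mu>0_nonneg]
    using \<mu>0_concentrated by (intro integral_eq_zero_AE) (auto simp: f_def)
  ultimately have "(LINT x|pos_part (\<mu> t). f x) \<le> 0"
    using wf(4) by (simp add: signed_integral_nonneg_measure[OF \<mu>_nonneg[OF t]])
  moreover have "0 \<le> (LINT x|pos_part (\<mu> t). f x)"
    by (intro integral_nonneg_AE AE_I2) (simp add: f_def)
  ultimately have "(LINT x|pos_part (\<mu> t). f x) = 0"
    by simp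
  then have "AE x in pos_part (\<mu> t). f x = 0"
    using integral_nonneg_eq_0_iff_AE[OF wf(1)] by (simp add: f_def)
  moreover have "AE x in pos_part (\<mu> t). 0 \<le> x"
    by (intro AE_I2) (simp add: space_pos_part)
  ultimately show ?thesis
    by eventually_elim (simp add: f_def max_def split: if_splits)
qed

lemma \<mu>_integral_mono:
  assumes t: "0 \<le> t" and f: "integrable (pos_part (\<mu> t)) f" and g: "integrable (pos_part (\<mu> t)) g"
    and le: "\<And>x. 0 \<le> x \<Longrightarrow> x \<le> L \<Longrightarrow> f x \<le> g x"
  shows "signed_integral (\<mu> t) f \<le> signed_integral (\<mu> t) g"
  unfolding signed_integral_nonneg_measure[OF \<mu>_nonneg[OF t]]
proof (rule integral_mono_AE[OF f g])
  show "AE x in pos_part (\<mu> t). f x \<le> g x"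
    using \<mu>_concentrated[OF t] by eventually_elim (simp add: le)
qed

lemma \<mu>_integrable:
  assumes "0 \<le> t" "bounded_borel f"
  shows "integrable (pos_part (\<mu> t)) f"
  by (intro bounded_borel_integrable finite_measure_pos_part nonneg_signed \<mu>_nonneg assms sets_pos_part)

lemma weight_bounds:
  assumes "0 \<le> x"
  shows "0 \<le> weight L x" "\<bar>weight L x\<bar> \<le> 1 + L powr max 1 (2 * \<gamma>)"
proof -
  show "0 \<le> weight L x"
    by (simp add: weight_def add_nonneg_nonneg)
  moreover have "min x L powr max 1 (2 * \<gamma>) \<le> L powr max 1 (2 * \<gamma>)"
    using assms L by (intro powr_mono2) auto
  ultimately show "\<bar>weight L x\<bar> \<le> 1 + L powr max 1 (2 * \<gamma>)"
    by (simp add: weight_def)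
qed

lemma bounded_borel_weight: "bounded_borel (weight L)"
  by (rule bounded_borel_continuous[OF weight_continuous[OF L] weight_bounds(2)])

lemma weight_integrable:
  assumes "0 \<le> t"
  shows "integrable (pos_part (\<mu> t)) (\<lambda>x. c * weight L x)"
  by (intro integrable_mult_right \<mu>_integrable bounded_borel_weight assms)

text \<open>
  The differential inequality \<open>A w \<le> \<alpha> N w\<close> holds on \<open>[0,L]\<close> only, which carries the solution.  Narrow
  continuity makes the moment continuous in time, as Gronwall's argument needs.
\<close>

lemma \<mu>_moment_bound:
  assumes t: "0 \<le> t"
  shows "signed_integral (\<mu> t) (weight L) \<le> 2 * signed_integral \<mu>0 (weight L) * exp (2 * (\<alpha> * N) * t)"
proof (rule Gronwall_integral[where T = t])
  show "0 < \<alpha> * N" using \<alpha> kernel_mass_ge_one by simp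
  show "0 \<le> signed_integral \<mu>0 (weight L)"
    unfolding signed_integral_nonneg_measure[OF \<mu>0_nonneg]
    by (intro integral_nonneg_AE AE_I2) (simp add: space_pos_part weight_bounds)
  have "bounded (weight L ` {0..})"
    unfolding bounded_iff using weight_bounds(2) by (intro exI[of _ "1 + L powr max 1 (2 * \<gamma>)"]) auto
  then have "continuous_on {0..} (\<lambda>t. signed_integral (\<mu> t) (weight L))"
    using solution weight_continuous[OF L]
    by (auto simp: nonneg_tv_solution_def measure_solution_def narrowly_continuous_def)
  then show cont: "continuous_on {0..t} (\<lambda>t. signed_integral (\<mu> t) (weight L))"
    by (rule continuous_on_subset) auto
  fix u assume u: "0 \<le> u" "u \<le> t"
  have "\<forall>x\<ge>0. \<bar>weight L x\<bar> \<le> (1 + L powr max 1 (2 * \<gamma>)) * (1 + x)"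
    by (intro allI impI at_most_linear weight_bounds)
  note wf = weak_formulation[OF weight_continuous[OF L] this u(1)]
  have "AE s in lborel. s \<in> {0..u} \<longrightarrow>
      signed_integral (\<mu> s) (A (weight L)) \<le> \<alpha> * N * signed_integral (\<mu> s) (weight L)"
    using wf(2)
  proof (eventually_elim, intro impI)
    fix s assume s: "s \<in> {0..u}" "s \<in> {0..u} \<longrightarrow> integrable (pos_part (\<mu> s)) (A (weight L))"
    have "signed_integral (\<mu> s) (A (weight L)) \<le> signed_integral (\<mu> s) (\<lambda>x. \<alpha> * N * weight L x)"
      using s by (intro \<mu>_integral_mono A_weight_le weight_integrable) auto
    then show "signed_integral (\<mu> s) (A (weight L)) \<le> \<alpha> * N * signed_integral (\<mu> s) (weight L)"
      using s by (simp add: signed_integral_nonneg_measure \<mu>_nonneg)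
  qed
  moreover have "set_integrable lborel {0..u} (\<lambda>s. \<alpha> * N * signed_integral (\<mu> s) (weight L))"
    using u by (intro borel_integrable_atLeastAtMost' continuous_intros continuous_on_subset[OF cont]) auto
  ultimately have "(LINT s:{0..u}|lborel. signed_integral (\<mu> s) (A (weight L))) \<le>
      (LINT s:{0..u}|lborel. \<alpha> * N * signed_integral (\<mu> s) (weight L))"
    using wf(3) unfolding set_lebesgue_integral_def set_integrable_def
    by (intro integral_mono_AE) (auto simp: indicator_def elim!: eventually_mono)
  then show "signed_integral (\<mu> u) (weight L) \<le> signed_integral \<mu>0 (weight L) +
      (LINT s:{0..u}|lborel. \<alpha> * N * signed_integral (\<mu> s) (weight L))"
    using wf(4) by simp
qed (use t in auto)

text \<open>
  The weak formulation is applied to \<open>\<phi>\<close> and once more to \<open>A \<phi>\<close>.  The remainder is controlled by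
  \<open>\<bar>A (A \<phi>)\<bar> \<le> (\<alpha> (1 + N))\<^sup>2 x\<^sup>2\<^sup>\<gamma>\<close>, hence by the moment of the weight.
\<close>

lemma second_order_expansion:
  assumes lip: "1-lipschitz_on {0..} \<phi>" and bd: "\<And>x. 0 \<le> x \<Longrightarrow> \<bar>\<phi> x\<bar> \<le> 1" and t: "0 \<le> t"
    and M: "\<And>s. 0 \<le> s \<Longrightarrow> s \<le> t \<Longrightarrow> signed_integral (\<mu> s) (weight L) \<le> M"
  shows "\<bar>signed_integral (\<mu> t) \<phi> - signed_integral \<mu>0 \<phi> - t * signed_integral \<mu>0 (A \<phi>)\<bar> \<le>
      (\<alpha> * (1 + N))\<^sup>2 * M * t\<^sup>2"
proof -
  define K where "K = (\<alpha> * (1 + N))\<^sup>2 * M"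
  \<comment> \<open>\<open>A \<phi>\<close> grows like \<open>x\<^sup>\<gamma>\<close>, too fast for a test function if \<open>\<gamma> > 1\<close>; the truncation is invisible to
    measures concentrated on \<open>[0,L]\<close>.\<close>
  define g where "g x = A \<phi> (min x L)" for x
  have N: "0 \<le> 1 + N" using kernel_mass_ge_one by simp
  have K: "0 \<le> K"
  proof -
    have "0 \<le> signed_integral (\<mu> 0) (weight L)"
      unfolding signed_integral_nonneg_measure[OF \<mu>_nonneg[OF order_refl]]
      by (intro integral_nonneg_AE AE_I2) (simp add: space_pos_part weight_bounds)
    then show ?thesis using M[of 0] t by (simp add: K_def)
  qed
  have g_cont: "continuous_on {0..} g"
    unfolding g_def
    by (rule continuous_on_compose2[OF A_continuous[OF lip bd]]) (use L in \<open>auto intro!: continuous_intros\<close>)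
  have g_le: "\<bar>g x\<bar> \<le> \<alpha> * (1 + N) * (min x L) powr \<gamma>" if "0 \<le> x" for x
    unfolding g_def using that L by (intro A_abs_le_powr[OF lip bd]) auto
  have g_bd: "\<bar>g x\<bar> \<le> \<alpha> * (1 + N) * L powr \<gamma>" if x: "0 \<le> x" for x
  proof -
    have "\<alpha> * (1 + N) * (min x L) powr \<gamma> \<le> \<alpha> * (1 + N) * L powr \<gamma>"
      using x L \<alpha> \<gamma> N by (intro mult_left_mono powr_mono2) auto
    then show ?thesis using g_le[OF x] by linarith
  qed
  have g_bb: "bounded_borel g"
    by (rule bounded_borel_continuous[OF g_cont g_bd])
  have g_eq: "signed_integral (\<mu> s) (A \<phi>) = signed_integral (\<mu> s) g" if s: "0 \<le> s" for s
    unfolding signed_integral_nonneg_measure[OF \<mu>_nonneg[OF s]]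
  proof (rule integral_cong_AE)
    show "A \<phi> \<in> borel_measurable (pos_part (\<mu> s))"
      using borel_measurable_continuous_on_restrict[OF A_continuous[OF lip bd]]
        measurable_cong_sets[OF sets_pos_part refl] by blast
    show "g \<in> borel_measurable (pos_part (\<mu> s))"
      using \<mu>_integrable[OF s g_bb] by simp
    show "AE x in pos_part (\<mu> s). A \<phi> x = g x"
      using \<mu>_concentrated[OF s] by eventually_elim (simp add: g_def)
  qed
  have Ag: "\<bar>A g x\<bar> \<le> (\<alpha> * (1 + N))\<^sup>2 * weight L x" if x: "0 \<le> x" "x \<le> L" for x
  proof -
    have "\<bar>A g x\<bar> \<le> \<alpha> * x powr \<gamma> * ((1 + N) * (\<alpha> * (1 + N) * x powr \<gamma>))"
    proof (rule A_abs_le[OF x(1)])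
      show "continuous_on {0..x} g"
        by (rule continuous_on_subset[OF g_cont]) auto
      show "\<bar>g y\<bar> \<le> \<alpha> * (1 + N) * x powr \<gamma>" if y: "0 \<le> y" "y \<le> x" for y
      proof -
        have "\<bar>g y\<bar> \<le> \<alpha> * (1 + N) * y powr \<gamma>"
          using g_le[of y] x y by simp
        also have "\<dots> \<le> \<alpha> * (1 + N) * x powr \<gamma>"
          using y \<alpha> \<gamma> N by (intro mult_left_mono powr_mono2) auto
        finally show ?thesis .
      qed
    qed
    also have "\<dots> = (\<alpha> * (1 + N))\<^sup>2 * x powr (2 * \<gamma>)"
      using powr_add[of x \<gamma> \<gamma>] by (simp add: power2_eq_square)
    also have "\<dots> \<le> (\<alpha> * (1 + N))\<^sup>2 * weight L x"
      using x \<gamma> by (intro mult_left_mono powr_le_weight) auto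
    finally show ?thesis .
  qed
  have first: "\<bar>signed_integral (\<mu> s) g - signed_integral \<mu>0 g\<bar> \<le> K * s" if s: "0 \<le> s" "s \<le> t" for s
  proof -
    have "\<forall>x\<ge>0. \<bar>g x\<bar> \<le> (\<alpha> * (1 + N) * L powr \<gamma>) * (1 + x)"
      by (intro allI impI at_most_linear g_bd)
    note wf = weak_formulation[OF g_cont this s(1)]
    have "AE r in lborel. r \<in> {0..s} \<longrightarrow> \<bar>signed_integral (\<mu> r) (A g)\<bar> \<le> K"
      using wf(2)
    proof (eventually_elim, intro impI)
      fix r assume r: "r \<in> {0..s}" "r \<in> {0..s} \<longrightarrow> integrable (pos_part (\<mu> r)) (A g)"
      have "signed_integral (\<mu> r) (\<lambda>x. \<bar>A g x\<bar>) \<le>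
          signed_integral (\<mu> r) (\<lambda>x. (\<alpha> * (1 + N))\<^sup>2 * weight L x)"
        using r Ag by (intro \<mu>_integral_mono integrable_abs weight_integrable) auto
      also have "\<dots> = (\<alpha> * (1 + N))\<^sup>2 * signed_integral (\<mu> r) (weight L)"
        using r by (simp add: signed_integral_nonneg_measure \<mu>_nonneg)
      also have "\<dots> \<le> K"
        unfolding K_def using M r s by (intro mult_left_mono) auto
      finally have *: "signed_integral (\<mu> r) (\<lambda>x. \<bar>A g x\<bar>) \<le> K" .
      have r0: "0 \<le> r" using r by simp
      show "\<bar>signed_integral (\<mu> r) (A g)\<bar> \<le> K"
        using * unfolding signed_integral_nonneg_measure[OF \<mu>_nonneg[OF r0]]
        by (rule order_trans[OF integral_abs_bound])
    qed
    then have "\<bar>LINT r:{0..s}|lborel. signed_integral (\<mu> r) (A g)\<bar> \<le> K * s"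
      using s wf(3) by (intro abs_set_integral_le)
    then show ?thesis using wf(4) by simp
  qed
  have \<phi>_bd: "\<forall>x\<ge>0. \<bar>\<phi> x\<bar> \<le> 1 * (1 + x)"
    by (intro allI impI at_most_linear bd)
  note wf = weak_formulation[OF \<phi>_continuous[OF lip bd] \<phi>_bd t]
  have const: "set_integrable lborel {0..t} (\<lambda>s. signed_integral \<mu>0 g)"
    by (intro borel_integrable_atLeastAtMost' continuous_intros)
  have "\<bar>signed_integral (\<mu> s) (A \<phi>) - signed_integral \<mu>0 g\<bar> \<le> K * t" if "s \<in> {0..t}" for s
  proof -
    have "K * s \<le> K * t" using K that by (intro mult_left_mono) auto
    then show ?thesis using first[of s] that by (simp add: g_eq)
  qed
  then have "\<bar>LINT s:{0..t}|lborel. signed_integral (\<mu> s) (A \<phi>) - signed_integral \<mu>0 g\<bar> \<le> K * t * t"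
    using t wf(3) const by (intro abs_set_integral_le set_integral_diff(1)) auto
  also have "(LINT s:{0..t}|lborel. signed_integral (\<mu> s) (A \<phi>) - signed_integral \<mu>0 g) =
      signed_integral (\<mu> t) \<phi> - signed_integral \<mu>0 \<phi> - t * signed_integral \<mu>0 (A \<phi>)"
    using wf(4) set_integral_diff(2)[OF wf(3) const] t g_eq[of 0]
    by (simp add: \<mu>_zero set_lebesgue_integral_def)
  finally show ?thesis
    by (simp add: K_def power2_eq_square mult.assoc)
qed

end

section \<open>Recovering the kernel\<close>

text \<open>
  The two constants collect, from the proof of \<open>kernel_from_short_time\<close>, the terms with a factor \<open>t\<^sup>2\<close>
  and those with a factor \<open>q\<close>.  In the second one \<open>D\<close> bounds \<open>\<xi> powr (\<gamma> - 1)\<close> on an interval carrying the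
  initial measure; the last factor is the bounded-Lipschitz size of the weight.
\<close>

definition time_constant :: "real \<Rightarrow> real \<Rightarrow> real \<Rightarrow> real" where
  "time_constant N T \<alpha> = \<alpha> + 4 * \<alpha> * (1 + N)\<^sup>2 * exp (2 * (\<alpha> * N) * T)"

definition data_constant :: "real \<Rightarrow> real \<Rightarrow> real \<Rightarrow> real \<Rightarrow> real \<Rightarrow> real \<Rightarrow> real" where
  "data_constant L N T \<alpha> \<gamma> D =
     1 + T * (\<alpha> * (1 + N) * L powr \<gamma>) + T * (\<alpha> * (2 * L powr \<gamma> + (1 + N) * (\<gamma> * D)))
     + 2 * (\<alpha> * (1 + N))\<^sup>2 * exp (2 * (\<alpha> * N) * T) * T\<^sup>2
       * (1 + L powr max 1 (2 * \<gamma>) + max 1 (2 * \<gamma>) * L powr (max 1 (2 * \<gamma>) - 1))"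

context fragmentation_solution
begin

text \<open>
  The function is known to be Lipschitz on \<open>[l,L]\<close> only.  Composition with the projection onto this
  interval extends it to the half line with the same constants, and changes neither integral since
  \<open>[l,L]\<close> contains both the support of \<open>\<mu>0\<close> and the point \<open>1\<close>.
\<close>

lemma initial_close_to_dirac:
  assumes close: "bl_norm (\<lambda>A. \<mu>0 A - dirac 1 A) \<le> q"
    and l: "0 \<le> l" "l \<le> 1" "1 \<le> L" and conc: "supp \<mu>0 \<subseteq> {l..L}"
    and f: "continuous_on {0..} f" and B: "0 < B"
    and lip: "\<And>x y. x \<in> {l..L} \<Longrightarrow> y \<in> {l..L} \<Longrightarrow> \<bar>f x - f y\<bar> \<le> B * \<bar>x - y\<bar>"
    and bd: "\<And>x. x \<in> {l..L} \<Longrightarrow> \<bar>f x\<bar> \<le> B"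
  shows "\<bar>signed_integral \<mu>0 f - f 1\<bar> \<le> B * q"
proof -
  define c where "c x = max l (min L x)" for x
  have c: "c x \<in> {l..L}" "\<bar>c x - c y\<bar> \<le> \<bar>x - y\<bar>" for x y
    using l by (auto simp: c_def)
  have Fbd: "\<bar>f (c x)\<bar> \<le> B" for x using bd c by simp
  have Flip: "\<bar>f (c x) - f (c y)\<bar> \<le> B * \<bar>x - y\<bar>" for x y
    using order_trans[OF lip[OF c(1) c(1)] mult_left_mono[OF c(2)]] B by simp
  have "B-lipschitz_on {0..} (\<lambda>x. f (c x))"
    using B Flip by (auto simp: lipschitz_on_def dist_real_def)
  then have F: "bounded_borel (\<lambda>x. f (c x))"
    by (rule bounded_borel_continuous[OF lipschitz_on_continuous_on Fbd])
  have "signed_integral \<mu>0 f = signed_integral \<mu>0 (\<lambda>x. f (c x))"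
    unfolding signed_integral_nonneg_measure[OF \<mu>0_nonneg]
  proof (rule integral_cong_AE)
    show "f \<in> borel_measurable (pos_part \<mu>0)"
      using borel_measurable_continuous_on_restrict[OF f]
        measurable_cong_sets[OF sets_pos_part refl] by blast
    show "(\<lambda>x. f (c x)) \<in> borel_measurable (pos_part \<mu>0)"
      using \<mu>_integrable[OF order_refl F] by (simp add: \<mu>_zero)
    show "AE x in pos_part \<mu>0. f x = f (c x)"
      using AE_supp[OF \<mu>0_nonneg]
    proof eventually_elim
      case (elim x)
      then have "x \<in> {l..L}" using conc by auto
      then show ?case by (simp add: c_def)
    qed
  qed
  moreover have "f 1 = signed_integral (dirac 1) (\<lambda>x. f (c x))"
    using signed_integral_dirac[of 1, OF _ F] l by (simp add: c_def)
  ultimately show ?thesis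
    using bl_norm_diff[OF nonneg_signed[OF \<mu>0_nonneg] nonneg_signed[OF dirac_nonneg[of 1]] close B Flip Fbd]
    by simp
qed

text \<open>
  At \<open>1\<close> the weight is \<open>2\<close> for every \<open>\<gamma>\<close> and \<open>L\<close>; these parameters occur only together with \<open>q\<close>.
\<close>

lemma initial_moment_bound:
  assumes close: "bl_norm (\<lambda>A. \<mu>0 A - dirac 1 A) \<le> q" and L1: "1 \<le> L"
  shows "signed_integral \<mu>0 (weight L) \<le>
     2 + (1 + L powr max 1 (2 * \<gamma>) + max 1 (2 * \<gamma>) * L powr (max 1 (2 * \<gamma>) - 1)) * q"
proof -
  define p where "p = max 1 (2 * \<gamma>)"
  define B where "B = 1 + L powr p + p * L powr (p - 1)"
  have p: "1 \<le> p" by (simp add: p_def)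
  have B: "0 < B" using p by (simp add: B_def add_pos_nonneg)
  have "\<bar>signed_integral \<mu>0 (weight L) - weight L 1\<bar> \<le> B * q"
  proof (rule initial_close_to_dirac[OF close order_refl _ L1 \<mu>0_supp weight_continuous[OF L] B])
    show "\<bar>weight L x\<bar> \<le> B" if "x \<in> {0..L}" for x
    proof -
      have "\<bar>weight L x\<bar> \<le> 1 + L powr p" using weight_bounds(2)[of x] that by (simp add: p_def)
      moreover have "0 \<le> p * L powr (p - 1)" using p by simp
      ultimately show ?thesis by (simp add: B_def)
    qed
    show "\<bar>weight L x - weight L y\<bar> \<le> B * \<bar>x - y\<bar>" if xy: "x \<in> {0..L}" "y \<in> {0..L}" for x y
    proof -
      have "\<bar>x powr p - y powr p\<bar> \<le> p * L powr (p - 1) * \<bar>x - y\<bar>"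
        using p xy by (intro powr_diff_le[where l = 0 and L = L]) (auto intro!: powr_mono2)
      also have "\<dots> \<le> B * \<bar>x - y\<bar>"
        by (intro mult_right_mono) (auto simp: B_def)
      finally show ?thesis using xy by (simp add: weight_def p_def)
    qed
  qed simp
  moreover have "weight L 1 = 2" using L1 by (simp add: weight_def)
  ultimately show ?thesis by (simp add: B_def p_def)
qed

text \<open>
  The error splits into the Taylor remainder, the error of replacing \<open>\<mu>0\<close> by the Dirac mass in the
  integral of \<open>h = (1 - e\<^sup>-\<^sup>\<alpha>\<^sup>t) \<phi> + t A \<phi>\<close>, and \<open>h(1) - \<alpha> t \<langle>\<kappa>, \<phi>\<rangle> = (1 - e\<^sup>-\<^sup>\<alpha>\<^sup>t - \<alpha> t) \<phi>(1)\<close>.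
\<close>

lemma kernel_from_short_time:
  assumes lip: "1-lipschitz_on {0..} \<phi>" and bd: "\<And>x. 0 \<le> x \<Longrightarrow> \<bar>\<phi> x\<bar> \<le> 1"
    and close: "bl_norm (\<lambda>A. \<mu>0 A - dirac 1 A) \<le> q"
    and l: "0 \<le> l" "l \<le> 1" "1 \<le> L" and conc: "supp \<mu>0 \<subseteq> {l..L}"
    and D: "0 \<le> D" "\<And>\<xi>. l < \<xi> \<Longrightarrow> \<xi> < L \<Longrightarrow> \<xi> powr (\<gamma> - 1) \<le> D"
    and t: "0 < t" "t \<le> T"
  shows "\<bar>signed_integral (\<mu> t) \<phi> - exp (- \<alpha> * t) * signed_integral \<mu>0 \<phi> - \<alpha> * t * signed_integral \<kappa> \<phi>\<bar> \<le>
     time_constant N T \<alpha> * t * (\<alpha> * t) + data_constant L N T \<alpha> \<gamma> D * q"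
proof -
  define p where "p = max 1 (2 * \<gamma>)"
  define Bw where "Bw = 1 + L powr p + p * L powr (p - 1)"
  define G where "G = \<alpha> * (1 + N) * L powr \<gamma>"
  define \<Lambda> where "\<Lambda> = \<alpha> * (2 * L powr \<gamma> + (1 + N) * (\<gamma> * D))"
  define B where "B = 1 + T * G + T * \<Lambda>"
  define X where "X = exp (2 * (\<alpha> * N) * T)"
  define h where "h x = (1 - exp (- \<alpha> * t)) * \<phi> x + t * A \<phi> x" for x
  have N: "1 \<le> N" by (rule kernel_mass_ge_one)
  have T: "0 < T" using t by simp
  have pos: "0 \<le> G" "0 \<le> \<Lambda>" "0 \<le> Bw" "0 \<le> X"
    using \<alpha> \<gamma> N D(1) by (auto simp: G_def \<Lambda>_def Bw_def X_def p_def intro!: add_nonneg_nonneg mult_nonneg_nonneg)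
  have B: "0 < B" "1 + t * G \<le> B" "1 + t * \<Lambda> \<le> B"
    using pos T t mult_right_mono[of t T G] mult_right_mono[of t T \<Lambda>]
      mult_nonneg_nonneg[of T G] mult_nonneg_nonneg[of T \<Lambda>] unfolding B_def by linarith+
  have e: "0 \<le> 1 - exp (- \<alpha> * t)" "1 - exp (- \<alpha> * t) \<le> 1"
    using \<alpha> t by auto
  have \<phi>_cont: "continuous_on {0..} \<phi>" by (rule \<phi>_continuous[OF lip bd])
  have A_cont: "continuous_on {0..} (A \<phi>)" by (rule A_continuous[OF lip bd])
  have "\<bar>signed_integral \<mu>0 h - h 1\<bar> \<le> B * q"
  proof (rule initial_close_to_dirac[OF close l conc _ B(1)])
    show "continuous_on {0..} h"
      unfolding h_def by (intro continuous_intros \<phi>_cont A_cont)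
    show "\<bar>h x\<bar> \<le> B" if x: "x \<in> {l..L}" for x
    proof -
      have "\<bar>A \<phi> x\<bar> \<le> \<alpha> * (1 + N) * x powr \<gamma>"
        using x l by (intro A_abs_le_powr[OF lip bd]) auto
      also have "\<dots> \<le> G"
        unfolding G_def using x l \<alpha> \<gamma> N by (intro mult_left_mono powr_mono2) auto
      finally have "\<bar>t * A \<phi> x\<bar> \<le> t * G"
        using t by (simp add: abs_mult)
      moreover have "\<bar>(1 - exp (- \<alpha> * t)) * \<phi> x\<bar> \<le> 1 * 1"
        unfolding abs_mult using e bd[of x] x l by (intro mult_mono) auto
      ultimately show ?thesis
        using B(2) abs_triangle_ineq[of "(1 - exp (- \<alpha> * t)) * \<phi> x" "t * A \<phi> x"]
        unfolding h_def by linarith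
    qed
    show "\<bar>h x - h y\<bar> \<le> B * \<bar>x - y\<bar>" if xy: "x \<in> {l..L}" "y \<in> {l..L}" for x y
    proof -
      have "\<bar>A \<phi> x - A \<phi> y\<bar> \<le> \<Lambda> * \<bar>x - y\<bar>"
        unfolding \<Lambda>_def by (rule A_lipschitz[OF lip bd l(1) D(2) xy])
      then have "\<bar>t * (A \<phi> x - A \<phi> y)\<bar> \<le> t * (\<Lambda> * \<bar>x - y\<bar>)"
        using t by (simp add: abs_mult)
      moreover have "\<bar>(1 - exp (- \<alpha> * t)) * (\<phi> x - \<phi> y)\<bar> \<le> 1 * \<bar>x - y\<bar>"
        unfolding abs_mult using e lip_le[OF lip bd, of x y] xy l by (intro mult_mono) auto
      ultimately have "\<bar>(1 - exp (- \<alpha> * t)) * (\<phi> x - \<phi> y) + t * (A \<phi> x - A \<phi> y)\<bar> \<le> (1 + t * \<Lambda>) * \<bar>x - y\<bar>"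
        using abs_triangle_ineq[of "(1 - exp (- \<alpha> * t)) * (\<phi> x - \<phi> y)" "t * (A \<phi> x - A \<phi> y)"]
        by (simp add: distrib_right mult.assoc)
      also have "\<dots> \<le> B * \<bar>x - y\<bar>"
        using B(3) by (intro mult_right_mono) auto
      finally show ?thesis
        by (simp add: h_def algebra_simps)
    qed
  qed
  moreover have "signed_integral \<mu>0 h =
      (1 - exp (- \<alpha> * t)) * signed_integral \<mu>0 \<phi> + t * signed_integral \<mu>0 (A \<phi>)"
  proof -
    have A_int: "integrable (pos_part \<mu>0) (A \<phi>)"
    proof (rule finite_measure.integrable_const_bound)
      show "finite_measure (pos_part \<mu>0)"
        by (intro finite_measure_pos_part nonneg_signed \<mu>0_nonneg)
      show "A \<phi> \<in> borel_measurable (pos_part \<mu>0)"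
        using borel_measurable_continuous_on_restrict[OF A_cont]
          measurable_cong_sets[OF sets_pos_part refl] by blast
      show "AE x in pos_part \<mu>0. norm (A \<phi> x) \<le> G"
        using \<mu>0_concentrated
      proof eventually_elim
        case (elim x)
        then have "\<bar>A \<phi> x\<bar> \<le> \<alpha> * (1 + N) * x powr \<gamma>"
          by (intro A_abs_le_powr[OF lip bd]) auto
        also have "\<dots> \<le> G"
          unfolding G_def using elim \<alpha> \<gamma> N by (intro mult_left_mono powr_mono2) auto
        finally show ?case by simp
      qed
    qed
    have "integrable (pos_part \<mu>0) \<phi>"
      using \<mu>_integrable[OF order_refl bounded_borel_continuous[OF \<phi>_cont bd]] by (simp add: \<mu>_zero)
    with A_int show ?thesis
      unfolding signed_integral_nonneg_measure[OF \<mu>0_nonneg] h_def by simp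
  qed
  moreover have "\<bar>h 1 - \<alpha> * t * signed_integral \<kappa> \<phi>\<bar> \<le> (\<alpha> * t)\<^sup>2"
  proof -
    have "h 1 - \<alpha> * t * signed_integral \<kappa> \<phi> = (1 - exp (- (\<alpha> * t)) - \<alpha> * t) * \<phi> 1"
      using kernel_integral_eq[OF \<phi>_cont bd] by (simp add: h_def A_eq algebra_simps)
    also have "\<bar>\<dots>\<bar> \<le> (\<alpha> * t)\<^sup>2 * 1"
      unfolding abs_mult using exp_minus_second_order[of "\<alpha> * t"] bd[of 1] \<alpha> t by (intro mult_mono) auto
    finally show ?thesis by simp
  qed
  moreover have "\<bar>signed_integral (\<mu> t) \<phi> - signed_integral \<mu>0 \<phi> - t * signed_integral \<mu>0 (A \<phi>)\<bar> \<le>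
      (\<alpha> * (1 + N))\<^sup>2 * (2 * (2 + Bw * q) * X) * t\<^sup>2"
  proof (rule second_order_expansion[OF lip bd])
    fix s assume s: "0 \<le> s" "s \<le> t"
    have w0: "0 \<le> signed_integral \<mu>0 (weight L)"
      unfolding signed_integral_nonneg_measure[OF \<mu>0_nonneg]
      by (intro integral_nonneg_AE AE_I2) (simp add: space_pos_part weight_bounds)
    have w1: "signed_integral \<mu>0 (weight L) \<le> 2 + Bw * q"
      using initial_moment_bound[OF close l(3)] by (simp add: Bw_def p_def)
    have "signed_integral (\<mu> s) (weight L) \<le> 2 * signed_integral \<mu>0 (weight L) * exp (2 * (\<alpha> * N) * s)"
      by (rule \<mu>_moment_bound[OF s(1)])
    also have "\<dots> \<le> 2 * (2 + Bw * q) * X"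
      unfolding X_def using w0 w1 s t \<alpha> N by (intro mult_mono) auto
    finally show "signed_integral (\<mu> s) (weight L) \<le> 2 * (2 + Bw * q) * X" .
  qed (use t in auto)
  moreover have "(\<alpha> * (1 + N))\<^sup>2 * (2 * (2 + Bw * q) * X) * t\<^sup>2 \<le>
      4 * \<alpha> * (1 + N)\<^sup>2 * X * t * (\<alpha> * t) + 2 * (\<alpha> * (1 + N))\<^sup>2 * X * T\<^sup>2 * Bw * q"
  proof -
    have "0 \<le> q"
    proof -
      have "0 \<le> \<bar>signed_integral \<mu>0 (\<lambda>_. 0) - 0\<bar>" by simp
      also have "\<dots> \<le> 1 * q"
        by (rule initial_close_to_dirac[OF close l conc]) auto
      finally show ?thesis by simp
    qed
    then have "(2 * (\<alpha> * (1 + N))\<^sup>2 * X * Bw * q) * t\<^sup>2 \<le> (2 * (\<alpha> * (1 + N))\<^sup>2 * X * Bw * q) * T\<^sup>2"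
      using pos t by (intro mult_left_mono power_mono mult_nonneg_nonneg) auto
    then show ?thesis
      by (simp add: algebra_simps power2_eq_square)
  qed
  ultimately have "\<bar>signed_integral (\<mu> t) \<phi> - exp (- \<alpha> * t) * signed_integral \<mu>0 \<phi> - \<alpha> * t * signed_integral \<kappa> \<phi>\<bar> \<le>
      B * q + (\<alpha> * t)\<^sup>2 + (4 * \<alpha> * (1 + N)\<^sup>2 * X * t * (\<alpha> * t) + 2 * (\<alpha> * (1 + N))\<^sup>2 * X * T\<^sup>2 * Bw * q)"
    unfolding left_diff_distrib by linarith
  also have "\<dots> = time_constant N T \<alpha> * t * (\<alpha> * t) + data_constant L N T \<alpha> \<gamma> D * q"
    unfolding time_constant_def data_constant_def B_def Bw_def G_def \<Lambda>_def X_def p_def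
    by (simp add: algebra_simps power2_eq_square)
  finally show ?thesis .
qed

end

text \<open>
  Linearity in the measure separates the noise from the exact quotient.  The initial error is damped
  by \<open>e\<^sup>-\<^sup>\<alpha>\<^sup>t \<le> 1\<close>, so both errors enter with coefficient at most \<open>1\<close>.
\<close>

lemma noisy_kernel_estimate:
  assumes frag: "fragmentation_solution \<alpha> \<gamma> \<kappa> N \<mu>0 \<mu> L"
    and close: "bl_norm (\<lambda>A. \<mu>0 A - dirac 1 A) \<le> q"
    and l: "0 \<le> l" "l \<le> 1" "1 \<le> L" and conc: "supp \<mu>0 \<subseteq> {l..L}"
    and D: "0 \<le> D" "\<And>\<xi>. l < \<xi> \<Longrightarrow> \<xi> < L \<Longrightarrow> \<xi> powr (\<gamma> - 1) \<le> D"
    and t: "0 < t" "t \<le> T"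
    and noisy0: "\<mu>0_noisy \<in> signed_measures" "bl_norm (\<lambda>A. \<mu>0_noisy A - \<mu>0 A) \<le> \<epsilon>0"
    and noisyt: "\<mu>t_noisy \<in> signed_measures" "bl_norm (\<lambda>A. \<mu>t_noisy A - \<mu> t A) \<le> \<epsilon>"
  shows "bl_norm (\<lambda>A. (\<mu>t_noisy A - exp (- \<alpha> * t) * \<mu>0_noisy A) / (\<alpha> * t) - \<kappa> A)
    \<le> time_constant N T \<alpha> * t + (\<epsilon>0 + \<epsilon> + data_constant L N T \<alpha> \<gamma> D * q) / (\<alpha> * t)"
proof (rule bl_norm_least)
  interpret fragmentation_solution \<alpha> \<gamma> \<kappa> N \<mu>0 \<mu> L by (rule frag)
  fix \<phi> :: "real \<Rightarrow> real" assume lip: "1-lipschitz_on {0..} \<phi>" and bd: "\<And>x. 0 \<le> x \<Longrightarrow> \<bar>\<phi> x\<bar> \<le> (1::real)"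
  define e where "e = exp (- \<alpha> * t)"
  have e: "0 \<le> e" "e \<le> 1" using \<alpha> t by (auto simp: e_def)
  have at: "0 < \<alpha> * t" using \<alpha> t by simp
  have bb: "bounded_borel \<phi>"
    by (rule bounded_borel_continuous[OF \<phi>_continuous[OF lip bd] bd])
  have lip': "\<bar>\<phi> x - \<phi> y\<bar> \<le> 1 * \<bar>x - y\<bar>" if "0 \<le> x" "0 \<le> y" for x y
    using lip_le[OF lip bd that] by simp
  have 0: "\<bar>signed_integral \<mu>0_noisy \<phi> - signed_integral \<mu>0 \<phi>\<bar> \<le> 1 * \<epsilon>0"
    by (rule bl_norm_diff[OF noisy0(1) nonneg_signed[OF \<mu>0_nonneg] noisy0(2) _ lip' bd]) auto
  have 1: "\<bar>signed_integral \<mu>t_noisy \<phi> - signed_integral (\<mu> t) \<phi>\<bar> \<le> 1 * \<epsilon>"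
    by (rule bl_norm_diff[OF noisyt(1) nonneg_signed[OF \<mu>_nonneg] noisyt(2) _ lip' bd]) (use t in auto)
  have "e * (signed_integral \<mu>0 \<phi> - signed_integral \<mu>0_noisy \<phi>) \<le> 1 * \<epsilon>0"
  proof -
    have "e * (signed_integral \<mu>0 \<phi> - signed_integral \<mu>0_noisy \<phi>) \<le> e * \<epsilon>0"
      using 0 e by (intro mult_left_mono) auto
    also have "\<dots> \<le> 1 * \<epsilon>0"
      using 0 e by (intro mult_right_mono) auto
    finally show ?thesis .
  qed
  then have "signed_integral \<mu>t_noisy \<phi> - e * signed_integral \<mu>0_noisy \<phi> - \<alpha> * t * signed_integral \<kappa> \<phi> \<le>
      \<epsilon>0 + \<epsilon> + (signed_integral (\<mu> t) \<phi> - e * signed_integral \<mu>0 \<phi> - \<alpha> * t * signed_integral \<kappa> \<phi>)"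
    using 1 unfolding right_diff_distrib by linarith
  also have "\<dots> \<le> \<epsilon>0 + \<epsilon> + (time_constant N T \<alpha> * t * (\<alpha> * t) + data_constant L N T \<alpha> \<gamma> D * q)"
    using kernel_from_short_time[OF lip bd close l conc D t] unfolding e_def by linarith
  finally have main: "signed_integral \<mu>t_noisy \<phi> - e * signed_integral \<mu>0_noisy \<phi> - \<alpha> * t * signed_integral \<kappa> \<phi> \<le>
      \<epsilon>0 + \<epsilon> + (time_constant N T \<alpha> * t * (\<alpha> * t) + data_constant L N T \<alpha> \<gamma> D * q)" .
  define \<rho> where "\<rho> A = 1 * \<mu>t_noisy A + (- e) * \<mu>0_noisy A" for A
  have \<rho>: "\<rho> \<in> signed_measures"
    unfolding \<rho>_def by (rule signed_measures_linear[OF noisyt(1) noisy0(1)])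
  have quotient: "(\<lambda>A. (\<mu>t_noisy A - exp (- \<alpha> * t) * \<mu>0_noisy A) / (\<alpha> * t) - \<kappa> A) =
      (\<lambda>A. 1 / (\<alpha> * t) * \<rho> A + (- 1) * \<kappa> A)"
    by (simp add: \<rho>_def e_def fun_eq_iff)
  have "signed_integral (\<lambda>A. (\<mu>t_noisy A - exp (- \<alpha> * t) * \<mu>0_noisy A) / (\<alpha> * t) - \<kappa> A) \<phi> =
      1 / (\<alpha> * t) * signed_integral \<rho> \<phi> + (- 1) * signed_integral \<kappa> \<phi>"
    unfolding quotient by (rule signed_integral_measure_linear[OF \<rho> \<kappa>_signed bb])
  also have "signed_integral \<rho> \<phi> = signed_integral \<mu>t_noisy \<phi> - e * signed_integral \<mu>0_noisy \<phi>"
    unfolding \<rho>_def signed_integral_measure_linear[OF noisyt(1) noisy0(1) bb] by simp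
  also have "1 / (\<alpha> * t) * (signed_integral \<mu>t_noisy \<phi> - e * signed_integral \<mu>0_noisy \<phi>) + (- 1) * signed_integral \<kappa> \<phi> =
      (signed_integral \<mu>t_noisy \<phi> - e * signed_integral \<mu>0_noisy \<phi> - \<alpha> * t * signed_integral \<kappa> \<phi>) / (\<alpha> * t)"
    using \<alpha> t by (simp add: diff_divide_distrib)
  also have "\<dots> \<le> (\<epsilon>0 + \<epsilon> + (time_constant N T \<alpha> * t * (\<alpha> * t) + data_constant L N T \<alpha> \<gamma> D * q)) / (\<alpha> * t)"
    using main at by (intro divide_right_mono) auto
  also have "\<dots> = time_constant N T \<alpha> * t + (\<epsilon>0 + \<epsilon> + data_constant L N T \<alpha> \<gamma> D * q) / (\<alpha> * t)"
    using \<alpha> t by (simp add: add_divide_distrib)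
  finally show "signed_integral (\<lambda>A. (\<mu>t_noisy A - exp (- \<alpha> * t) * \<mu>0_noisy A) / (\<alpha> * t) - \<kappa> A) \<phi> \<le>
      time_constant N T \<alpha> * t + (\<epsilon>0 + \<epsilon> + data_constant L N T \<alpha> \<gamma> D * q) / (\<alpha> * t)" .
qed

lemma powr_le_sum_endpoints:
  fixes \<xi> p :: real
  assumes "0 < l" "l \<le> \<xi>" "\<xi> \<le> L"
  shows "\<xi> powr p \<le> L powr p + l powr p"
proof (cases "0 \<le> p")
  case True
  then have "\<xi> powr p \<le> L powr p" using assms by (intro powr_mono2) auto
  then show ?thesis by (simp add: add_increasing2)
next
  case False
  then have "\<xi> powr p \<le> l powr p" using assms by (intro powr_mono2') auto
  then show ?thesis by (simp add: add_increasing)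
qed

text \<open>
  The interval on which \<open>\<mu>0\<close> lives is enlarged to \<open>[min 1 m, max 1 L]\<close>, so that it contains \<open>1\<close>.  On it,
  \<open>\<xi> powr (\<gamma> - 1)\<close> is at most the sum of its values at \<open>max 1 L\<close>, \<open>1\<close> and \<open>m\<close>; the argument \<open>y\<close> stands for
  \<open>m powr (\<gamma> - 1)\<close>.  For \<open>\<gamma> \<ge> 1\<close> the value at \<open>max 1 L\<close> suffices and \<open>y = 0\<close> works.
\<close>

definition support_constant :: "real \<Rightarrow> real \<Rightarrow> real \<Rightarrow> real \<Rightarrow> real \<Rightarrow> real \<Rightarrow> real" where
  "support_constant L N T \<alpha> \<gamma> y = data_constant (max 1 L) N T \<alpha> \<gamma> (max 1 L powr (\<gamma> - 1) + 1 + y)"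

theorem theorem6:
  shows "\<exists>(C1 :: real \<times> real \<times> real \<Rightarrow> real)
      (C2 :: real \<times> real \<times> real \<times> real \<times> real \<Rightarrow> real)
      (C2' :: real \<times> real \<times> real \<times> real \<times> real \<times> real \<Rightarrow> real).
    continuous_on ({0<..} \<times> {0<..} \<times> {0<..}) C1 \<and>
    continuous_on ({0..} \<times> {0<..} \<times> {0<..} \<times> {0<..} \<times> {1..}) C2 \<and>
    continuous_on ({0..} \<times> {0<..} \<times> {0<..} \<times> {0<..} \<times> {0<..} \<times> {0<..}) C2' \<and>
    (\<forall>\<alpha>>0. \<forall>\<gamma>>0. \<forall>T>0. \<forall>N \<kappa>. \<forall>q\<ge>0. \<forall>L\<ge>0. \<forall>\<mu>0 \<mu> \<mu>0_noisy \<epsilon>0.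
       frag_kernel N \<kappa> \<and>
       \<mu>0 \<in> nonneg_measures \<and> supp \<mu>0 \<subseteq> {0..L} \<and>
       bl_norm (\<lambda>A. \<mu>0 A - dirac 1 A) \<le> q \<and>
       nonneg_tv_solution \<alpha> \<gamma> \<kappa> \<mu>0 \<mu> \<and>
       \<mu>0_noisy \<in> signed_measures \<and> bl_norm (\<lambda>A. \<mu>0_noisy A - \<mu>0 A) \<le> \<epsilon>0 \<longrightarrow>
       (\<forall>t \<mu>t_noisy \<epsilon>.
          0 < t \<and> t \<le> T \<and>
          \<mu>t_noisy \<in> signed_measures \<and> bl_norm (\<lambda>A. \<mu>t_noisy A - \<mu> t A) \<le> \<epsilon> \<longrightarrow>
          (1 \<le> \<gamma> \<longrightarrow>
             bl_norm (\<lambda>A. (\<mu>t_noisy A - exp (- \<alpha> * t) * \<mu>0_noisy A) / (\<alpha> * t) - \<kappa> A)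
               \<le> C1 (N, T, \<alpha>) * t + (\<epsilon>0 + \<epsilon> + C2 (L, N, T, \<alpha>, \<gamma>) * q) / (\<alpha> * t)) \<and>
          (\<forall>m>0. supp \<mu>0 \<subseteq> {m..L} \<longrightarrow>
             bl_norm (\<lambda>A. (\<mu>t_noisy A - exp (- \<alpha> * t) * \<mu>0_noisy A) / (\<alpha> * t) - \<kappa> A)
               \<le> C1 (N, T, \<alpha>) * t
                   + (\<epsilon>0 + \<epsilon> + C2' (L, N, T, \<alpha>, \<gamma>, m powr (\<gamma> - 1)) * q) / (\<alpha> * t))))"
proof (rule exI[of _ "\<lambda>(N, T, \<alpha>). time_constant N T \<alpha>"],
    rule exI[of _ "\<lambda>(L, N, T, \<alpha>, \<gamma>). support_constant L N T \<alpha> \<gamma> 0"],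
    rule exI[of _ "\<lambda>(L, N, T, \<alpha>, \<gamma>, y). support_constant L N T \<alpha> \<gamma> y"],
    intro conjI allI impI; (elim conjE)?)
  show "continuous_on ({0<..} \<times> {0<..} \<times> {0<..}) (\<lambda>(N, T, \<alpha>). time_constant N T \<alpha>)"
    unfolding time_constant_def split_beta by (intro continuous_intros)
  show "continuous_on ({0..} \<times> {0<..} \<times> {0<..} \<times> {0<..} \<times> {1..})
      (\<lambda>(L, N, T, \<alpha>, \<gamma>). support_constant L N T \<alpha> \<gamma> 0)"
    unfolding support_constant_def data_constant_def split_beta
    by (intro continuous_intros ballI) (simp_all add: max_def)
  show "continuous_on ({0..} \<times> {0<..} \<times> {0<..} \<times> {0<..} \<times> {0<..} \<times> {0<..})
      (\<lambda>(L, N, T, \<alpha>, \<gamma>, y). support_constant L N T \<alpha> \<gamma> y)"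
    unfolding support_constant_def data_constant_def split_beta
    by (intro continuous_intros ballI) (simp_all add: max_def)
next
  fix \<alpha> \<gamma> T N q L \<epsilon>0 t \<epsilon> :: real and \<kappa> \<mu>0 \<mu>0_noisy \<mu>t_noisy :: "real set \<Rightarrow> real"
    and \<mu> :: "real \<Rightarrow> real set \<Rightarrow> real"
  assume pos: "0 < \<alpha>" "0 < \<gamma>" "0 < T" "0 \<le> q" "0 \<le> L" and kernel: "frag_kernel N \<kappa>"
    and \<mu>0: "\<mu>0 \<in> nonneg_measures" "supp \<mu>0 \<subseteq> {0..L}"
    and close: "bl_norm (\<lambda>A. \<mu>0 A - dirac 1 A) \<le> q"
    and sol: "nonneg_tv_solution \<alpha> \<gamma> \<kappa> \<mu>0 \<mu>"
    and noisy0: "\<mu>0_noisy \<in> signed_measures" "bl_norm (\<lambda>A. \<mu>0_noisy A - \<mu>0 A) \<le> \<epsilon>0"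
    and t: "0 < t" "t \<le> T"
    and noisyt: "\<mu>t_noisy \<in> signed_measures" "bl_norm (\<lambda>A. \<mu>t_noisy A - \<mu> t A) \<le> \<epsilon>"
  have supp': "supp \<mu>0 \<subseteq> {0..max 1 L}" using \<mu>0(2) by force
  have frag: "fragmentation_solution \<alpha> \<gamma> \<kappa> N \<mu>0 \<mu> (max 1 L)"
    using pos kernel \<mu>0 supp' sol by unfold_locales auto
  show "bl_norm (\<lambda>A. (\<mu>t_noisy A - exp (- \<alpha> * t) * \<mu>0_noisy A) / (\<alpha> * t) - \<kappa> A)
      \<le> (case (N, T, \<alpha>) of (N, T, \<alpha>) \<Rightarrow> time_constant N T \<alpha>) * t +
        (\<epsilon>0 + \<epsilon> + (case (L, N, T, \<alpha>, \<gamma>) of (L, N, T, \<alpha>, \<gamma>) \<Rightarrow> support_constant L N T \<alpha> \<gamma> 0) * q) / (\<alpha> * t)"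
    if \<gamma>1: "1 \<le> \<gamma>"
    unfolding support_constant_def prod.case
  proof (rule noisy_kernel_estimate[OF frag close, of 0, OF _ _ _ supp' _ _ t noisy0 noisyt])
    show "\<xi> powr (\<gamma> - 1) \<le> max 1 L powr (\<gamma> - 1) + 1 + 0" if "0 < \<xi>" "\<xi> < max 1 L" for \<xi>
      using powr_mono2[of "\<gamma> - 1" \<xi> "max 1 L"] that \<gamma>1 by simp
  qed simp_all
  show "bl_norm (\<lambda>A. (\<mu>t_noisy A - exp (- \<alpha> * t) * \<mu>0_noisy A) / (\<alpha> * t) - \<kappa> A)
      \<le> (case (N, T, \<alpha>) of (N, T, \<alpha>) \<Rightarrow> time_constant N T \<alpha>) * t +
        (\<epsilon>0 + \<epsilon> + (case (L, N, T, \<alpha>, \<gamma>, m powr (\<gamma> - 1)) of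
          (L, N, T, \<alpha>, \<gamma>, y) \<Rightarrow> support_constant L N T \<alpha> \<gamma> y) * q) / (\<alpha> * t)"
    if m: "0 < m" "supp \<mu>0 \<subseteq> {m..L}" for m
    unfolding support_constant_def prod.case
  proof (rule noisy_kernel_estimate[OF frag close, of "min 1 m", OF _ _ _ _ _ _ t noisy0 noisyt])
    show "supp \<mu>0 \<subseteq> {min 1 m..max 1 L}" using m(2) by force
    show "\<xi> powr (\<gamma> - 1) \<le> max 1 L powr (\<gamma> - 1) + 1 + m powr (\<gamma> - 1)"
      if "min 1 m < \<xi>" "\<xi> < max 1 L" for \<xi>
    proof -
      have "\<xi> powr (\<gamma> - 1) \<le> max 1 L powr (\<gamma> - 1) + min 1 m powr (\<gamma> - 1)"
        using that m(1) by (intro powr_le_sum_endpoints) auto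
      also have "min 1 m powr (\<gamma> - 1) \<le> 1 + m powr (\<gamma> - 1)"
        by (simp add: min_def)
      finally show ?thesis by simp
    qed
  qed (use m in simp_all)
qed

end
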